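(* Let $r>0$, $R>0$, and suppose the eigenvalues of $\mathbf{H}$ are $\lambda_j=j^{-(1+r)}$, $j\ge1$. Assume that: $\mathbb{E}[y^2\mid x]<\infty$ almost surely; there is $\tau>0$ with $\mathbf{M}(\mathbf{A})\preceq\tau\,\mathrm{tr}[\mathbf{H}\mathbf{A}]\,\mathbf{H}$ for every PSD operator $\mathbf{A}$; $\sigma^2:=\|\mathbf{H}^{-1/2}\boldsymbol{\Sigma}\mathbf{H}^{-1/2}\|<\infty$; $0<\gamma<\min\big\{1,\frac1{\tau\,\mathrm{tr}[\mathbf{H}]}\big\}$; $w_1=0$; and $\|w^*\|\le R$. If the numbers of local nodes satisfy $$M_n\le\Big(\frac{\gamma}{R^2}\Big)^{\frac{1+r}{2+r}}(\gamma n)^{\frac1{2+r}},$$ then for all sufficiently large $n$, $$\mathbb{E}\big[L(\overline{\overline{w}}_{M_n})\big]-L(w^* )\ \le\ c\,\frac{\gamma}{M_n}\Big(\frac{M_n}n\Big)^{\frac r{1+r}},$$ for some constant $c<\infty$ (independent of $n$) depending on $\tau,\gamma,\sigma$.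
   Context: Model. $\mathcal{H}$ is a real separable Hilbert space, $(x,y)\in\mathcal{H}\times\mathbb{R}$ a random pair with $y=\langle w^*,x\rangle+\epsilon$. $L(w)=\frac12\mathbb{E}[(y-\langle w,x\rangle)^2]$, and $w^*$ is the minimum-norm minimizer of $L$ over $\mathcal{H}$. $\mathbf{H}=\mathbb{E}[x\otimes x]$; $\mathbf{M}(\mathbf{A})w=\mathbb{E}[\langle x,\mathbf{A}x\rangle\langle w,x\rangle x]$; $\boldsymbol{\Sigma}=\mathbb{E}[(\langle w^*,x\rangle-y)^2\,x\otimes x]$; $\|\mathbf{H}^{-1/2}\boldsymbol{\Sigma}\mathbf{H}^{-1/2}\|$ is the smallest constant $s$ with $\boldsymbol{\Sigma}\preceq s\,\mathbf{H}$. Distributed SGD. $n$ i.i.d. copies of $(x,y)$ are split evenly into $M=M_n$ disjoint local data sets $(x^{(m)}_t,y^{(m)}_t)_{t=1}^{n/M}$, $m=1,\dots,M$ ($M$ divides $n$). With stepsize $\gamma$ and $w^{(m)}_1=w_1$, $$w^{(m)}_{t+1}=w^{(m)}_t-\gamma\big(\langle w^{(m)}_t,x^{(m)}_t\rangle-y^{(m)}_t\big)x^{(m)}_t,$$ $\bar w^{(m)}=\frac Mn\sum_{t=1}^{n/M}w^{(m)}_t$ and $\overline{\overline{w}}_M=\frac1M\sum_{m=1}^M\bar w^{(m)}$. *)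

theory Defs
  imports "HOL-Probability.Probability"
begin

text \<open>
  Operators on the Hilbert space are plain functions.  Expectations of operators are taken
  pointwise as Bochner integrals in the Hilbert space; since a non-integrable function has Bochner
  integral 0, existence of the integral is a separate predicate.
\<close>

definition psd_operator :: "('h::real_inner \<Rightarrow> 'h) \<Rightarrow> bool" where
  "psd_operator A \<longleftrightarrow>
     bounded_linear A \<and> (\<forall>u v. A u \<bullet> v = u \<bullet> A v) \<and> (\<forall>u. 0 \<le> A u \<bullet> u)"

definition loewner_le :: "('h::real_inner \<Rightarrow> 'h) \<Rightarrow> ('h \<Rightarrow> 'h) \<Rightarrow> bool" where
  "loewner_le A B \<longleftrightarrow> (\<forall>u. A u \<bullet> u \<le> B u \<bullet> u)"

definition complete_orthonormal :: "'h::real_inner set \<Rightarrow> bool" where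
  "complete_orthonormal B \<longleftrightarrow>
     (\<forall>u\<in>B. \<forall>v\<in>B. u \<bullet> v = (if u = v then 1 else 0)) \<and>
     (\<forall>w. (\<forall>u\<in>B. u \<bullet> w = 0) \<longrightarrow> w = 0)"

text \<open>
  The trace of a trace class operator does not depend on the orthonormal basis, so any choice does.
\<close>

definition operator_trace :: "('h::real_inner \<Rightarrow> 'h) \<Rightarrow> real" where
  "operator_trace T = (\<Sum>\<^sub>\<infinity>u\<in>(SOME B. complete_orthonormal B). T u \<bullet> u)"

text \<open>
  The sequence lists the nonzero eigenvalues of a compact self-adjoint operator, repeated according
  to multiplicity; the operator may have a kernel.
\<close>

definition eigenvalue_sequence :: "('h::real_inner \<Rightarrow> 'h) \<Rightarrow> (nat \<Rightarrow> real) \<Rightarrow> bool" where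
  "eigenvalue_sequence T lam \<longleftrightarrow>
     (\<exists>e :: nat \<Rightarrow> 'h.
        (\<forall>i j. e i \<bullet> e j = (if i = j then 1 else 0)) \<and>
        (\<forall>j. T (e j) = lam j *\<^sub>R e j) \<and>
        (\<forall>u. (\<forall>j. e j \<bullet> u = 0) \<longrightarrow> T u = 0))"

text \<open>The operator \<open>\<bbbE>[f \<cdot> (x \<otimes> x)]\<close> for a real random variable \<open>f\<close>.\<close>

definition moment_operator ::
  "'w measure \<Rightarrow> ('w \<Rightarrow> real) \<Rightarrow> ('w \<Rightarrow> 'h) \<Rightarrow> 'h \<Rightarrow> 'h::{real_inner, banach, second_countable_topology}"
  where "moment_operator P f X w = (\<integral>\<omega>. (f \<omega> * (w \<bullet> X \<omega>)) *\<^sub>R X \<omega> \<partial>P)"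

definition moment_operator_exists ::
  "'w measure \<Rightarrow> ('w \<Rightarrow> real) \<Rightarrow> ('w \<Rightarrow> 'h::{real_inner, banach, second_countable_topology}) \<Rightarrow> bool"
  where "moment_operator_exists P f X \<longleftrightarrow>
    (\<forall>w. integrable P (\<lambda>\<omega>. (f \<omega> * (w \<bullet> X \<omega>)) *\<^sub>R X \<omega>))"

abbreviation covariance ::
  "'w measure \<Rightarrow> ('w \<Rightarrow> 'h) \<Rightarrow> 'h \<Rightarrow> 'h::{real_inner, banach, second_countable_topology}"
  where "covariance P X \<equiv> moment_operator P (\<lambda>_. 1) X"

abbreviation covariance_exists ::
  "'w measure \<Rightarrow> ('w \<Rightarrow> 'h::{real_inner, banach, second_countable_topology}) \<Rightarrow> bool"
  where "covariance_exists P X \<equiv> moment_operator_exists P (\<lambda>_. 1) X"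

definition fourth_moment_bound ::
  "'w measure \<Rightarrow> ('w \<Rightarrow> 'h::{real_inner, banach, second_countable_topology}) \<Rightarrow> real \<Rightarrow> bool"
  where "fourth_moment_bound P X \<tau> \<longleftrightarrow>
    (\<forall>A. psd_operator A \<longrightarrow>
       moment_operator_exists P (\<lambda>\<omega>. X \<omega> \<bullet> A (X \<omega>)) X \<and>
       loewner_le (moment_operator P (\<lambda>\<omega>. X \<omega> \<bullet> A (X \<omega>)) X)
         (\<lambda>w. (\<tau> * operator_trace (covariance P X \<circ> A)) *\<^sub>R covariance P X w))"

text \<open>
  \<open>\<parallel>H\<^sup>-\<^sup>1\<^sup>/\<^sup>2 \<Sigma> H\<^sup>-\<^sup>1\<^sup>/\<^sup>2\<parallel>\<close>, the least \<open>s\<close> with \<open>\<Sigma> \<preceq> s H\<close>, and infinite if there is none.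
\<close>

definition whitened_noise_norm ::
  "'w measure \<Rightarrow> ('w \<Rightarrow> 'h::{real_inner, banach, second_countable_topology}) \<Rightarrow> ('w \<Rightarrow> real) \<Rightarrow> 'h \<Rightarrow> ennreal"
  where "whitened_noise_norm P X Y ws =
    Inf {ennreal s | s. 0 \<le> s \<and>
      moment_operator_exists P (\<lambda>\<omega>. (ws \<bullet> X \<omega> - Y \<omega>)\<^sup>2) X \<and>
      loewner_le (moment_operator P (\<lambda>\<omega>. (ws \<bullet> X \<omega> - Y \<omega>)\<^sup>2) X)
        (\<lambda>w. s *\<^sub>R covariance P X w)}"

text \<open>
  The risk takes values in \<open>[0, \<infinity>]\<close>, so an upper bound on its expectation includes integrability.
  A bound on the excess risk is stated with the minimal risk added on the right-hand side.
\<close>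

definition risk ::
  "'w measure \<Rightarrow> ('w \<Rightarrow> 'h::real_inner) \<Rightarrow> ('w \<Rightarrow> real) \<Rightarrow> 'h \<Rightarrow> ennreal" where
  "risk P X Y w = (\<integral>\<^sup>+\<omega>. ennreal ((Y \<omega> - w \<bullet> X \<omega>)\<^sup>2) \<partial>P) / 2"

definition min_norm_minimizer :: "('h::real_normed_vector \<Rightarrow> ennreal) \<Rightarrow> 'h \<Rightarrow> bool" where
  "min_norm_minimizer L w \<longleftrightarrow>
     (\<forall>v. L w \<le> L v) \<and> (\<forall>v. (\<forall>u. L v \<le> L u) \<longrightarrow> norm w \<le> norm v)"

text \<open>
  Times and nodes are numbered from 0: \<open>sgd \<gamma> w1 z t\<close> is the iterate \<open>w\<^sub>t\<^sub>+\<^sub>1\<close>, obtained from the data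
  points \<open>z 0, \<dots>, z (t - 1)\<close>.  The average over \<open>T\<close> steps hence does not use \<open>z (T - 1)\<close>.
\<close>

primrec sgd :: "real \<Rightarrow> 'h::real_inner \<Rightarrow> (nat \<Rightarrow> 'h \<times> real) \<Rightarrow> nat \<Rightarrow> 'h" where
  "sgd \<gamma> w1 z 0 = w1"
| "sgd \<gamma> w1 z (Suc t) =
     sgd \<gamma> w1 z t - (\<gamma> * (sgd \<gamma> w1 z t \<bullet> fst (z t) - snd (z t))) *\<^sub>R fst (z t)"

definition sgd_average :: "real \<Rightarrow> 'h::real_inner \<Rightarrow> nat \<Rightarrow> (nat \<Rightarrow> 'h \<times> real) \<Rightarrow> 'h" where
  "sgd_average \<gamma> w1 T z = (1 / real T) *\<^sub>R (\<Sum>t<T. sgd \<gamma> w1 z t)"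

definition distributed_sgd ::
  "real \<Rightarrow> 'h::real_inner \<Rightarrow> nat \<Rightarrow> nat \<Rightarrow> (nat \<Rightarrow> nat \<Rightarrow> 'h \<times> real) \<Rightarrow> 'h" where
  "distributed_sgd \<gamma> w1 M n z =
     (1 / real M) *\<^sub>R (\<Sum>m<M. sgd_average \<gamma> w1 (n div M) (z m))"

text \<open>
  \<open>Z m t\<close> is the data point used by node \<open>m\<close> at time \<open>t\<close>; if \<open>M\<close> divides \<open>n\<close>, there are \<open>n\<close> of them.
\<close>

definition iid_split_sample ::
  "'w measure \<Rightarrow> ('w \<Rightarrow> 'h::{real_inner, banach, second_countable_topology}) \<Rightarrow> ('w \<Rightarrow> real) \<Rightarrow>
     nat \<Rightarrow> nat \<Rightarrow> (nat \<Rightarrow> nat \<Rightarrow> 'w \<Rightarrow> 'h \<times> real) \<Rightarrow> bool" where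
  "iid_split_sample P X Y M n Z \<longleftrightarrow>
     prob_space.indep_vars P (\<lambda>_. borel) (\<lambda>(m, t). Z m t) ({..<M} \<times> {..<n div M}) \<and>
     (\<forall>m<M. \<forall>t<n div M. distr P borel (Z m t) = distr P borel (\<lambda>\<omega>. (X \<omega>, Y \<omega>)))"

end

theory Submission
  imports Defs
begin

text \<open>
  In the eigenbasis of the covariance every coordinate of the error of one node satisfies the scalar
  recursion \<open>a\<^sub>t\<^sub>+\<^sub>1 = (1 - \<gamma> \<lambda>) a\<^sub>t + \<gamma> f\<^sub>t\<close>, where the \<open>f\<^sub>t\<close> of all nodes and times are centred and
  pairwise orthogonal in \<open>L\<^sup>2\<close>.  The second moment of the averaged coordinate is hence the squared
  bias plus the sum of the second moments of the \<open>f\<^sub>t\<close>, weighted by geometric sums bounded by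
  \<open>min T (1 / (\<gamma> \<lambda>))\<close>.  By the fourth moment condition for rank one operators, \<open>\<bbbE>[f\<^sub>t\<^sup>2]\<close> is at most
  a multiple of \<open>\<lambda> (\<tau> \<bbbE>[\<langle>\<eta>\<^sub>t, H \<eta>\<^sub>t\<rangle>] + \<sigma>\<^sup>2)\<close>, where \<open>\<eta>\<^sub>t\<close> is the error of the node, and the descent
  inequality for \<open>\<bbbE>[\<parallel>\<eta>\<^sub>t\<parallel>\<^sup>2]\<close> bounds the sum over \<open>t\<close> of \<open>\<bbbE>[\<langle>\<eta>\<^sub>t, H \<eta>\<^sub>t\<rangle>]\<close>.  Summing over the
  coordinates gives the bias \<open>\<parallel>w\<^sup>*\<parallel>\<^sup>2 / (\<gamma> T)\<close> and the variance \<open>\<sigma>\<^sup>2 d / (M T)\<close> up to constants, with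
  effective dimension \<open>d\<close> of order \<open>T\<^sup>1\<^sup>/\<^sup>(\<^sup>1\<^sup>+\<^sup>r\<^sup>)\<close>; the bound on \<open>M\<close> makes the bias at most of the
  order of the variance.
\<close>

section \<open>Orthonormal expansions and traces\<close>

lemma norm_sum_orthonormal:
  fixes e :: "'i \<Rightarrow> 'h::real_inner"
  assumes on: "\<And>i j. i \<in> F \<Longrightarrow> j \<in> F \<Longrightarrow> e i \<bullet> e j = (if i = j then 1 else 0)"
    and F: "finite F"
  shows "(norm (\<Sum>i\<in>F. c i *\<^sub>R e i))\<^sup>2 = (\<Sum>i\<in>F. (c i)\<^sup>2)"
proof -
  have "(norm (\<Sum>i\<in>F. c i *\<^sub>R e i))\<^sup>2 = (\<Sum>i\<in>F. \<Sum>j\<in>F. c i * c j * (e i \<bullet> e j))"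
    by (simp add: power2_norm_eq_inner inner_sum_left inner_sum_right sum_distrib_left mult_ac
        inner_commute)
  also have "\<dots> = (\<Sum>i\<in>F. \<Sum>j\<in>F. if i = j then (c i)\<^sup>2 else 0)"
    by (intro sum.cong refl) (simp add: on power2_eq_square)
  also have "\<dots> = (\<Sum>i\<in>F. (c i)\<^sup>2)"
    using F by simp
  finally show ?thesis .
qed

lemma bessel_finite:
  fixes e :: "'i \<Rightarrow> 'h::real_inner"
  assumes on: "\<And>i j. i \<in> F \<Longrightarrow> j \<in> F \<Longrightarrow> e i \<bullet> e j = (if i = j then 1 else 0)"
    and F: "finite F"
  shows "(\<Sum>i\<in>F. (v \<bullet> e i)\<^sup>2) \<le> (norm v)\<^sup>2"
proof -
  let ?p = "\<Sum>i\<in>F. (v \<bullet> e i) *\<^sub>R e i"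
  have vp: "v \<bullet> ?p = (\<Sum>i\<in>F. (v \<bullet> e i)\<^sup>2)"
    by (simp add: inner_sum_right power2_eq_square)
  have "0 \<le> (norm (v - ?p))\<^sup>2" by simp
  also have "\<dots> = (norm v)\<^sup>2 - 2 * (v \<bullet> ?p) + (norm ?p)\<^sup>2"
    by (simp add: power2_norm_eq_inner inner_diff_left inner_diff_right inner_commute)
  also have "\<dots> = (norm v)\<^sup>2 - (\<Sum>i\<in>F. (v \<bullet> e i)\<^sup>2)"
    using norm_sum_orthonormal[of F e "\<lambda>i. v \<bullet> e i"] on F vp by simp
  finally show ?thesis by simp
qed

text \<open>For nested finite index sets, the difference of the partial sums has as squared norm a
  sum of squared coefficients. Those are summable by Bessel's inequality, so the partial sums form a
  Cauchy net, which converges by completeness.\<close>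

lemma fourier_summable:
  fixes e :: "'i \<Rightarrow> 'h::{real_inner, banach}"
  assumes on: "\<And>i j. i \<in> A \<Longrightarrow> j \<in> A \<Longrightarrow> e i \<bullet> e j = (if i = j then 1 else 0)"
  shows "(\<lambda>i. (v \<bullet> e i) *\<^sub>R e i) summable_on A"
proof -
  let ?c = "\<lambda>i. (v \<bullet> e i)\<^sup>2" and ?f = "\<lambda>i. (v \<bullet> e i) *\<^sub>R e i"
  have bes: "sum ?c F \<le> (norm v)\<^sup>2" if "finite F" "F \<subseteq> A" for F
    using that on by (intro bessel_finite) blast+
  have "?c summable_on A"
    by (rule nonneg_bdd_above_summable_on) (auto intro!: bdd_aboveI2[where M = "(norm v)\<^sup>2"] bes)
  then obtain L where L: "(?c has_sum L) A"
    by (auto simp: summable_on_def)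
  have "\<exists>Q. eventually Q (finite_subsets_at_top A) \<and>
            (\<forall>F F'. Q F \<and> Q F' \<longrightarrow> dist (sum ?f F) (sum ?f F') < \<epsilon>)" if \<epsilon>: "\<epsilon> > 0" for \<epsilon>
  proof -
    have "eventually (\<lambda>F. dist (sum ?c F) L < (\<epsilon>/2)\<^sup>2) (finite_subsets_at_top A)"
      using L \<epsilon> unfolding has_sum_def by (intro tendstoD) auto
    then obtain F0 where F0: "finite F0" "F0 \<subseteq> A"
      and d: "\<forall>F. finite F \<and> F0 \<subseteq> F \<and> F \<subseteq> A \<longrightarrow> dist (sum ?c F) L < (\<epsilon>/2)\<^sup>2"
      unfolding eventually_finite_subsets_at_top by (elim exE conjE)
    define Q where "Q F \<longleftrightarrow> finite F \<and> F0 \<subseteq> F \<and> F \<subseteq> A" for F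
    have "dist (sum ?f F) (sum ?f F0) < \<epsilon>/2" if "Q F" for F
    proof -
      have F: "finite F" "F0 \<subseteq> F" "F \<subseteq> A" using that by (auto simp: Q_def)
      have "(dist (sum ?f F) (sum ?f F0))\<^sup>2 = (norm (sum ?f (F - F0)))\<^sup>2"
        unfolding dist_norm using F by (simp add: sum_diff)
      also have "\<dots> = sum ?c (F - F0)"
        using F by (intro norm_sum_orthonormal on) auto
      also have "\<dots> = sum ?c F - sum ?c F0"
        using F by (simp add: sum_diff)
      also have "\<dots> \<le> L - sum ?c F0"
        using finite_sum_le_has_sum[OF L F(1,3)] by simp
      also have "\<dots> < (\<epsilon>/2)\<^sup>2"
        using d[rule_format, of F0] F0 by (simp add: dist_real_def abs_less_iff)
      finally show ?thesis
        by (rule power_less_imp_less_base) (use \<epsilon> in simp)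
    qed
    then have "dist (sum ?f F) (sum ?f F') < \<epsilon>" if "Q F" "Q F'" for F F'
      using that dist_triangle_half_l by blast
    moreover have "eventually Q (finite_subsets_at_top A)"
      unfolding Q_def eventually_finite_subsets_at_top using F0 by (intro exI[of _ F0]) auto
    ultimately show ?thesis by blast
  qed
  then have "cauchy_filter (filtermap (sum ?f) (finite_subsets_at_top A))"
    by (simp add: cauchy_filter_metric_filtermap)
  moreover have "uniform_space_class.complete (UNIV::'h set)"
    by (meson Cauchy_convergent UNIV_I complete_def convergent_def)
  ultimately obtain p where "(sum ?f \<longlongrightarrow> p) (finite_subsets_at_top A)"
    using complete_uniform[where S=UNIV] by (force simp add: filterlim_def)
  then show ?thesis
    unfolding summable_on_def has_sum_def by blast
qed

text \<open>The remainder \<open>v - p\<close> need not vanish. \<open>parseval\<close> removes it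
  by completeness of the basis, and \<open>covariance_eigen_expansion\<close> places it in the
  kernel of the covariance.\<close>

lemma fourier_expansion:
  fixes e :: "'i \<Rightarrow> 'h::{real_inner, banach}"
  assumes on: "\<And>i j. i \<in> A \<Longrightarrow> j \<in> A \<Longrightarrow> e i \<bullet> e j = (if i = j then 1 else 0)"
  obtains p where "((\<lambda>i. (v \<bullet> e i) *\<^sub>R e i) has_sum p) A" "\<And>i. i \<in> A \<Longrightarrow> (v - p) \<bullet> e i = 0"
proof -
  obtain p where p: "((\<lambda>i. (v \<bullet> e i) *\<^sub>R e i) has_sum p) A"
    using fourier_summable[OF on] by (auto simp: summable_on_def)
  have "(v - p) \<bullet> e j = 0" if j: "j \<in> A" for j
  proof -
    have "((\<lambda>i. ((v \<bullet> e i) *\<^sub>R e i) \<bullet> e j) has_sum (p \<bullet> e j)) A"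
      by (rule has_sum_bounded_linear[OF bounded_linear_inner_left p])
    moreover have "((\<lambda>i. ((v \<bullet> e i) *\<^sub>R e i) \<bullet> e j) has_sum (v \<bullet> e j)) A"
      using has_sum_finiteI[of "{j}" "v \<bullet> e j" "\<lambda>i. ((v \<bullet> e i) *\<^sub>R e i) \<bullet> e j"] j on
      by (subst has_sum_cong_neutral[where T = "{j}" and g = "\<lambda>i. ((v \<bullet> e i) *\<^sub>R e i) \<bullet> e j"]) auto
    ultimately have "p \<bullet> e j = v \<bullet> e j"
      by (rule has_sum_unique)
    then show ?thesis
      by (simp add: inner_diff_left)
  qed
  with p show ?thesis by (rule that)
qed

lemma parseval:
  fixes v w :: "'h::{real_inner, banach}"
  assumes B: "complete_orthonormal B"
  shows "((\<lambda>u. (v \<bullet> u) * (w \<bullet> u)) has_sum (v \<bullet> w)) B"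
proof -
  have "\<And>i j. i \<in> B \<Longrightarrow> j \<in> B \<Longrightarrow> i \<bullet> j = (if i = j then 1 else 0)"
    using B by (auto simp: complete_orthonormal_def)
  then obtain p where p: "((\<lambda>u. (v \<bullet> u) *\<^sub>R u) has_sum p) B" "\<And>u. u \<in> B \<Longrightarrow> (v - p) \<bullet> u = 0"
    using fourier_expansion[of B "\<lambda>u. u" v] by metis
  have "v - p = 0"
    using B p(2) unfolding complete_orthonormal_def by (metis inner_commute)
  then show ?thesis
    using has_sum_bounded_linear[OF bounded_linear_inner_right p(1), of w] by (simp add: inner_commute)
qed

text \<open>Zorn's lemma gives a maximal orthonormal set, and a nonzero vector orthogonal to it
  could be normalised and added. Existence makes the \<open>SOME\<close> in
  \<open>operator_trace\<close> a genuine basis.\<close>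

lemma complete_orthonormal_exists:
  "\<exists>B :: 'h::{real_inner, banach} set. complete_orthonormal B"
proof -
  define \<A> :: "'h set set" where
    "\<A> = {B. \<forall>u\<in>B. \<forall>v\<in>B. u \<bullet> v = (if u = v then 1 else 0)}"
  have "\<Union>C \<in> \<A>" if C: "subset.chain \<A> C" for C
    unfolding \<A>_def
  proof (intro CollectI ballI)
    fix u v assume "u \<in> \<Union>C" "v \<in> \<Union>C"
    then obtain U V where UV: "U \<in> C" "V \<in> C" "u \<in> U" "v \<in> V" by blast
    then have "U \<subseteq> V \<or> V \<subseteq> U" using C by (auto simp: subset.chain_def)
    moreover have "U \<in> \<A>" "V \<in> \<A>" using C UV by (auto simp: subset.chain_def)
    ultimately show "u \<bullet> v = (if u = v then 1 else 0)"
      using UV unfolding \<A>_def by blast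
  qed
  then have "\<exists>B\<in>\<A>. \<forall>B'\<in>\<A>. B \<subseteq> B' \<longrightarrow> B' = B"
    by (rule subset_Zorn')
  then obtain B where B: "B \<in> \<A>" and max: "\<And>B'. B' \<in> \<A> \<Longrightarrow> B \<subseteq> B' \<Longrightarrow> B' = B"
    by blast
  have "w = 0" if w: "\<forall>u\<in>B. u \<bullet> w = 0" for w
  proof (rule ccontr)
    assume "w \<noteq> 0"
    let ?w = "sgn w"
    have ww: "?w \<bullet> ?w = 1"
      using \<open>w \<noteq> 0\<close> by (simp add: dot_square_norm norm_sgn)
    have wu: "u \<bullet> ?w = 0" if "u \<in> B" for u
      using w that by (simp add: sgn_div_norm)
    have "insert ?w B \<in> \<A>"
      using B ww wu by (auto simp: \<A>_def inner_commute)
    then have "?w \<in> B" using max by blast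
    then show False using ww wu by force
  qed
  then have "complete_orthonormal B"
    using B unfolding complete_orthonormal_def \<A>_def by blast
  then show ?thesis ..
qed

section \<open>Traces in the chosen orthonormal basis\<close>

lemma complete_orthonormal_some:
  "complete_orthonormal (SOME B :: 'h::{real_inner, banach} set. complete_orthonormal B)"
  using complete_orthonormal_exists by (rule someI_ex)

text \<open>Parseval's identity, since the diagonal entries are
  \<open>(v \<bullet> u) * (T v \<bullet> u)\<close>. This evaluates the trace in the fourth moment
  condition for rank one operators.\<close>

lemma operator_trace_rank_one:
  fixes T :: "'h::{real_inner, banach} \<Rightarrow> 'h"
  assumes "\<And>c v. T (c *\<^sub>R v) = c *\<^sub>R T v"
  shows "operator_trace (T \<circ> (\<lambda>w. (v \<bullet> w) *\<^sub>R v)) = T v \<bullet> v"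
proof -
  have "((\<lambda>u. (v \<bullet> u) * (T v \<bullet> u)) has_sum (v \<bullet> T v)) (SOME B. complete_orthonormal B)"
    by (rule parseval[OF complete_orthonormal_some])
  then have "((\<lambda>u. T ((v \<bullet> u) *\<^sub>R v) \<bullet> u) has_sum (T v \<bullet> v)) (SOME B. complete_orthonormal B)"
    by (simp add: assms inner_commute)
  then show ?thesis
    unfolding operator_trace_def comp_def by (rule infsumI)
qed

text \<open>
  The trace of a positive operator that is not of trace class is the value 0 of a divergent
  infinite sum, hence the hypothesis that it is positive.
\<close>

lemma sum_le_operator_trace:
  fixes T :: "'h::{real_inner, banach} \<Rightarrow> 'h" and e :: "'i \<Rightarrow> 'h"
  assumes tr: "operator_trace T > 0" and F: "finite F"
    and le: "\<And>u. (\<Sum>i\<in>F. lam i * (u \<bullet> e i)\<^sup>2) \<le> T u \<bullet> u"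
    and e: "\<And>i. i \<in> F \<Longrightarrow> norm (e i) = 1"
  shows "(\<Sum>i\<in>F. lam i) \<le> operator_trace T"
proof -
  let ?B = "SOME B :: 'h set. complete_orthonormal B"
  have "(\<lambda>u. T u \<bullet> u) summable_on ?B"
    using tr unfolding operator_trace_def by (metis infsum_not_exists less_irrefl)
  then have T: "((\<lambda>u. T u \<bullet> u) has_sum operator_trace T) ?B"
    unfolding operator_trace_def by (rule has_sum_infsum)
  have one: "((\<lambda>u. lam i * (u \<bullet> e i)\<^sup>2) has_sum lam i) ?B" if "i \<in> F" for i
    using has_sum_cmult_right[OF parseval[OF complete_orthonormal_some, of "e i" "e i"], of "lam i"] e[OF that]
    by (simp add: dot_square_norm power2_eq_square inner_commute)
  have "((\<lambda>u. \<Sum>i\<in>F. lam i * (u \<bullet> e i)\<^sup>2) has_sum (\<Sum>i\<in>F. lam i)) ?B"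
    using F one by (induction F rule: finite_induct) (auto intro!: has_sum_add)
  then show ?thesis
    using le by (rule has_sum_mono[OF _ T])
qed

section \<open>Independence and orthogonal sums\<close>

text \<open>
  \<open>indep_var\<close> only relates random variables of the same type, so independence is stated as equality of
  distributions.
\<close>

lemma (in prob_space) indep_nn_integral_pair:
  assumes W: "W \<in> measurable M N" and U: "U \<in> measurable M K" and V: "V \<in> measurable M K"
    and ind: "distr M (N \<Otimes>\<^sub>M K) (\<lambda>\<omega>. (W \<omega>, U \<omega>)) = distr M N W \<Otimes>\<^sub>M distr M K U"
    and d: "distr M K U = distr M K V"
    and f: "f \<in> borel_measurable (N \<Otimes>\<^sub>M K)"
  shows "(\<integral>\<^sup>+\<omega>. f (W \<omega>, U \<omega>) \<partial>M) = (\<integral>\<^sup>+\<omega>. \<integral>\<^sup>+\<omega>'. f (W \<omega>, V \<omega>') \<partial>M \<partial>M)"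
proof -
  note [measurable] = W U V f
  interpret K: prob_space "distr M K V" by (rule prob_space_distr) simp
  have "(\<integral>\<^sup>+\<omega>. f (W \<omega>, U \<omega>) \<partial>M) = (\<integral>\<^sup>+p. f p \<partial>distr M (N \<Otimes>\<^sub>M K) (\<lambda>\<omega>. (W \<omega>, U \<omega>)))"
    by (simp add: nn_integral_distr)
  also have "distr M (N \<Otimes>\<^sub>M K) (\<lambda>\<omega>. (W \<omega>, U \<omega>)) = distr M N W \<Otimes>\<^sub>M distr M K V"
    using ind d by simp
  also have "(\<integral>\<^sup>+p. f p \<partial>(distr M N W \<Otimes>\<^sub>M distr M K V)) = (\<integral>\<^sup>+w. \<integral>\<^sup>+z. f (w, z) \<partial>distr M K V \<partial>distr M N W)"
    by (rule K.nn_integral_fst[symmetric]) simp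
  also have "\<dots> = (\<integral>\<^sup>+\<omega>. \<integral>\<^sup>+z. f (W \<omega>, z) \<partial>distr M K V \<partial>M)"
    by (rule nn_integral_distr) measurable
  also have "\<dots> = (\<integral>\<^sup>+\<omega>. \<integral>\<^sup>+\<omega>'. f (W \<omega>, V \<omega>') \<partial>M \<partial>M)"
    by (intro nn_integral_cong nn_integral_distr) (use measurable_space[OF W] in measurable)
  finally show ?thesis .
qed

text \<open>Fubini replaces Tonelli, hence the integrability hypothesis. \<open>V\<close> is a
  reference copy of \<open>U\<close>: the inner integral averages over it while
  \<open>W \<omega>\<close> is frozen.\<close>

lemma (in prob_space) indep_integral_pair:
  fixes f :: "_ \<Rightarrow> real"
  assumes W: "W \<in> measurable M N" and U: "U \<in> measurable M K" and V: "V \<in> measurable M K"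
    and ind: "distr M (N \<Otimes>\<^sub>M K) (\<lambda>\<omega>. (W \<omega>, U \<omega>)) = distr M N W \<Otimes>\<^sub>M distr M K U"
    and d: "distr M K U = distr M K V"
    and f: "f \<in> borel_measurable (N \<Otimes>\<^sub>M K)" and int: "integrable M (\<lambda>\<omega>. f (W \<omega>, U \<omega>))"
  shows "(\<integral>\<omega>. f (W \<omega>, U \<omega>) \<partial>M) = (\<integral>\<omega>. \<integral>\<omega>'. f (W \<omega>, V \<omega>') \<partial>M \<partial>M)"
proof -
  note [measurable] = W U V f
  interpret N: prob_space "distr M N W" by (rule prob_space_distr) simp
  interpret K: prob_space "distr M K V" by (rule prob_space_distr) simp
  interpret NK: pair_prob_space "distr M N W" "distr M K V" ..
  have joint: "distr M (N \<Otimes>\<^sub>M K) (\<lambda>\<omega>. (W \<omega>, U \<omega>)) = distr M N W \<Otimes>\<^sub>M distr M K V"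
    using ind d by simp
  have "(\<integral>\<omega>. f (W \<omega>, U \<omega>) \<partial>M) = (\<integral>p. f p \<partial>distr M (N \<Otimes>\<^sub>M K) (\<lambda>\<omega>. (W \<omega>, U \<omega>)))"
    by (simp add: integral_distr)
  also have "\<dots> = (\<integral>w. \<integral>z. f (w, z) \<partial>distr M K V \<partial>distr M N W)"
    unfolding joint
  proof (rule NK.integral_fst'[symmetric])
    have "integrable (distr M (N \<Otimes>\<^sub>M K) (\<lambda>\<omega>. (W \<omega>, U \<omega>))) f"
      using int by (simp add: integrable_distr_eq)
    then show "integrable (distr M N W \<Otimes>\<^sub>M distr M K V) f"
      unfolding joint .
  qed
  also have "\<dots> = (\<integral>\<omega>. \<integral>z. f (W \<omega>, z) \<partial>distr M K V \<partial>M)"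
    by (rule integral_distr) measurable
  also have "\<dots> = (\<integral>\<omega>. \<integral>\<omega>'. f (W \<omega>, V \<omega>') \<partial>M \<partial>M)"
    by (intro Bochner_Integration.integral_cong refl integral_distr) (use measurable_space[OF W] in measurable)
  finally show ?thesis .
qed

section \<open>Square integrable variables, orthogonal sums and scalar recursions\<close>

lemma integrable_mult_of_squares:
  fixes f g :: "'a \<Rightarrow> real"
  assumes [measurable]: "f \<in> borel_measurable M" "g \<in> borel_measurable M"
    and "integrable M (\<lambda>x. (f x)\<^sup>2)" "integrable M (\<lambda>x. (g x)\<^sup>2)"
  shows "integrable M (\<lambda>x. f x * g x)"
proof (rule Bochner_Integration.integrable_bound)
  show "integrable M (\<lambda>x. (f x)\<^sup>2 + (g x)\<^sup>2)"
    using assms by simp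
  have "\<bar>a * b\<bar> \<le> a\<^sup>2 + b\<^sup>2" for a b :: real
  proof -
    have "2 * (\<bar>a\<bar> * \<bar>b\<bar>) \<le> a\<^sup>2 + b\<^sup>2"
      using sum_squares_bound[of "\<bar>a\<bar>" "\<bar>b\<bar>"] by (simp add: mult.assoc)
    moreover have "0 \<le> \<bar>a\<bar> * \<bar>b\<bar>" by simp
    ultimately show ?thesis unfolding abs_mult by linarith
  qed
  then show "AE x in M. norm (f x * g x) \<le> norm ((f x)\<^sup>2 + (g x)\<^sup>2)"
    by simp
qed simp

lemma (in prob_space) integrable_of_square:
  fixes f :: "'a \<Rightarrow> real"
  assumes "f \<in> borel_measurable M" "integrable M (\<lambda>x. (f x)\<^sup>2)"
  shows "integrable M f"
  using integrable_mult_of_squares[of f M "\<lambda>_. 1"] assms by simp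

text \<open>Pythagoras: in the expanded square the vanishing means kill the products with
  \<open>b\<close>, and orthogonality leaves only the diagonal of the double sum.\<close>

lemma (in prob_space) second_moment_orthogonal_sum:
  fixes f :: "'i \<Rightarrow> 'a \<Rightarrow> real"
  assumes I: "finite I" and meas: "\<And>i. i \<in> I \<Longrightarrow> f i \<in> borel_measurable M"
    and sq: "\<And>i. i \<in> I \<Longrightarrow> integrable M (\<lambda>x. (f i x)\<^sup>2)"
    and mean: "\<And>i. i \<in> I \<Longrightarrow> expectation (f i) = 0"
    and orth: "\<And>i j. i \<in> I \<Longrightarrow> j \<in> I \<Longrightarrow> i \<noteq> j \<Longrightarrow> expectation (\<lambda>x. f i x * f j x) = 0"
  shows "integrable M (\<lambda>x. (b + (\<Sum>i\<in>I. c i * f i x))\<^sup>2)" (is ?int)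
    and "expectation (\<lambda>x. (b + (\<Sum>i\<in>I. c i * f i x))\<^sup>2)
      = b\<^sup>2 + (\<Sum>i\<in>I. (c i)\<^sup>2 * expectation (\<lambda>x. (f i x)\<^sup>2))" (is ?eq)
proof -
  have expand: "(b + (\<Sum>i\<in>I. c i * f i x))\<^sup>2
      = b\<^sup>2 + 2 * b * (\<Sum>i\<in>I. c i * f i x) + (\<Sum>i\<in>I. \<Sum>j\<in>I. c i * c j * (f i x * f j x))" for x
    by (simp add: power2_sum power2_eq_square[of "sum _ _"] sum_product mult_ac)
  have i1: "integrable M (f i)" if "i \<in> I" for i
    by (rule integrable_of_square[OF meas[OF that] sq[OF that]])
  have i2: "integrable M (\<lambda>x. f i x * f j x)" if "i \<in> I" "j \<in> I" for i j
    using that by (auto intro!: integrable_mult_of_squares[OF meas meas sq sq])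
  show ?int
    unfolding expand using i1 i2 by auto
  have "expectation (\<lambda>x. (b + (\<Sum>i\<in>I. c i * f i x))\<^sup>2)
      = b\<^sup>2 + 2 * b * (\<Sum>i\<in>I. c i * expectation (f i))
        + (\<Sum>i\<in>I. \<Sum>j\<in>I. c i * c j * expectation (\<lambda>x. f i x * f j x))"
    unfolding expand using i1 i2 by (simp add: prob_space)
  also have "(\<Sum>i\<in>I. c i * expectation (f i)) = 0"
    using mean by simp
  also have "(\<Sum>i\<in>I. \<Sum>j\<in>I. c i * c j * expectation (\<lambda>x. f i x * f j x))
      = (\<Sum>i\<in>I. \<Sum>j\<in>I. if i = j then (c i)\<^sup>2 * expectation (\<lambda>x. (f i x)\<^sup>2) else 0)"
    by (intro sum.cong refl) (auto simp: orth power2_eq_square)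
  finally show ?eq
    using I by simp
qed

text \<open>The input \<open>f s\<close> first enters \<open>a (Suc s)\<close> and is then
  multiplied by \<rho> at every step, so it occurs in \<open>T - 1 - s\<close> of the summed terms.
  The last input \<open>f (T - 1)\<close> gets an empty weight.\<close>

lemma sum_affine_recurrence:
  fixes a f :: "nat \<Rightarrow> real"
  assumes "\<And>t. a (Suc t) = \<rho> * a t + \<gamma> * f t"
  shows "(\<Sum>t<T. a t) = a 0 * (\<Sum>k<T. \<rho> ^ k) + \<gamma> * (\<Sum>s<T. (\<Sum>k<T - 1 - s. \<rho> ^ k) * f s)"
proof (induction T)
  case (Suc T)
  have G: "(\<Sum>k<Suc n. \<rho> ^ k) = 1 + \<rho> * (\<Sum>k<n. \<rho> ^ k)" for n
    by (subst sum.lessThan_Suc_shift) (simp add: sum_distrib_left)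
  \<comment> \<open>Splitting off \<open>a 0\<close> and applying the recursion to all later terms
    leaves the sum of length \<open>T\<close> from the induction hypothesis.\<close>
  have "(\<Sum>t<Suc T. a t) = a 0 + (\<rho> * (\<Sum>t<T. a t) + \<gamma> * (\<Sum>s<T. f s))"
    by (subst sum.lessThan_Suc_shift) (simp add: assms sum.distrib sum_distrib_left)
  also have "\<dots> = a 0 * (\<Sum>k<Suc T. \<rho> ^ k)
      + \<gamma> * (\<Sum>s<T. (1 + \<rho> * (\<Sum>k<T - 1 - s. \<rho> ^ k)) * f s)"
    unfolding Suc.IH G by (simp add: algebra_simps sum.distrib sum_distrib_left)
  also have "(\<Sum>s<T. (1 + \<rho> * (\<Sum>k<T - 1 - s. \<rho> ^ k)) * f s) = (\<Sum>s<T. (\<Sum>k<T - s. \<rho> ^ k) * f s)"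
    unfolding G[symmetric] by (intro sum.cong refl) (auto simp: Suc_diff_Suc simp del: sum.lessThan_Suc)
  finally show ?case by simp
qed simp

text \<open>The sum is at most the minimum of \<open>n\<close> and \<open>1 / x\<close>; the second
  bound is kept as a product so that it also covers \<open>x = 0\<close>.\<close>

lemma geometric_sum_bounds:
  fixes x :: real
  assumes "0 \<le> x" "x \<le> 1"
  shows "0 \<le> (\<Sum>k<n. (1 - x) ^ k)" "(\<Sum>k<n. (1 - x) ^ k) \<le> real n" "x * (\<Sum>k<n. (1 - x) ^ k) \<le> 1"
proof -
  show "0 \<le> (\<Sum>k<n. (1 - x) ^ k)"
    using assms by (intro sum_nonneg) simp
  have "(\<Sum>k<n. (1 - x) ^ k) \<le> (\<Sum>k<n. 1)"
    using assms by (intro sum_mono power_le_one) auto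
  then show "(\<Sum>k<n. (1 - x) ^ k) \<le> real n" by simp
  have "x * (\<Sum>k<n. (1 - x) ^ k) = 1 - (1 - x) ^ n"
    using one_diff_power_eq[of "1 - x" n] by simp
  then show "x * (\<Sum>k<n. (1 - x) ^ k) \<le> 1"
    using assms by simp
qed

section \<open>One step of stochastic gradient descent\<close>

text \<open>The operator hypotheses appear in scalar form, tested on the eigenvectors
  \<open>e j\<close> of the covariance. \<open>suminf lam\<close> stands for its trace and
  \<open>s\<close> for the squared noise level.\<close>

locale least_squares = prob_space P
  for P :: "'w measure" +
  fixes X :: "'w \<Rightarrow> 'h::{real_inner, banach, second_countable_topology}" and Y :: "'w \<Rightarrow> real"
    and ws :: 'h and e :: "nat \<Rightarrow> 'h" and lam :: "nat \<Rightarrow> real" and \<tau> s \<gamma> :: real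
  assumes X[measurable]: "X \<in> borel_measurable P" and Y[measurable]: "Y \<in> borel_measurable P"
    and orthonormal: "e i \<bullet> e j = (if i = j then 1 else 0)"
    and lam_nonneg: "0 \<le> lam j" and lam_le_1: "lam j \<le> 1" and summable_lam: "summable lam"
    and integrable_square: "integrable P (\<lambda>\<omega>. (v \<bullet> X \<omega>)\<^sup>2)"
    and covariance_eigen: "(\<integral>\<omega>. (v \<bullet> X \<omega>) * (e j \<bullet> X \<omega>) \<partial>P) = lam j * (v \<bullet> e j)"
    and second_moment_sums: "(\<lambda>j. lam j * (v \<bullet> e j)\<^sup>2) sums (\<integral>\<omega>. (v \<bullet> X \<omega>)\<^sup>2 \<partial>P)"
    and integrable_residual: "integrable P (\<lambda>\<omega>. (Y \<omega> - ws \<bullet> X \<omega>) * (e j \<bullet> X \<omega>))"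
    and residual_orthogonal: "(\<integral>\<omega>. (Y \<omega> - ws \<bullet> X \<omega>) * (e j \<bullet> X \<omega>) \<partial>P) = 0"
    and integrable_noise: "integrable P (\<lambda>\<omega>. ((Y \<omega> - ws \<bullet> X \<omega>) * (e j \<bullet> X \<omega>))\<^sup>2)"
    and noise_bound: "(\<integral>\<omega>. ((Y \<omega> - ws \<bullet> X \<omega>) * (e j \<bullet> X \<omega>))\<^sup>2 \<partial>P) \<le> s * lam j"
    and integrable_fourth: "integrable P (\<lambda>\<omega>. ((v \<bullet> X \<omega>) * (e j \<bullet> X \<omega>))\<^sup>2)"
    and fourth_bound: "(\<integral>\<omega>. ((v \<bullet> X \<omega>) * (e j \<bullet> X \<omega>))\<^sup>2 \<partial>P)
      \<le> \<tau> * (\<integral>\<omega>. (v \<bullet> X \<omega>)\<^sup>2 \<partial>P) * lam j"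
    and tau_nonneg: "0 \<le> \<tau>" and s_nonneg: "0 \<le> s"
    and gamma_pos: "0 < \<gamma>" and gamma_le_1: "\<gamma> \<le> 1"
    and gamma_tau: "\<gamma> * \<tau> * suminf lam \<le> 1"
begin

text \<open>The quadratic form of the covariance, twice the excess risk at
  \<open>ws + v\<close>.\<close>

definition h :: "'h \<Rightarrow> real" where "h v = (\<integral>\<omega>. (v \<bullet> X \<omega>)\<^sup>2 \<partial>P)"

text \<open>The argument \<open>v\<close> is the error, not the iterate: this is coordinate
  \<open>j\<close> of the stochastic gradient at \<open>ws + v\<close>.\<close>

definition grad :: "nat \<Rightarrow> 'h \<Rightarrow> 'h \<times> real \<Rightarrow> real" where
  "grad j v z = (v \<bullet> fst z - (snd z - ws \<bullet> fst z)) * (e j \<bullet> fst z)"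

definition step :: "'h \<Rightarrow> 'h \<times> real \<Rightarrow> 'h" where
  "step v z = v - (\<gamma> * (v \<bullet> fst z - (snd z - ws \<bullet> fst z))) *\<^sub>R fst z"

text \<open>Squared norm of the projection of \<open>v\<close> onto the closed span of the
  \<open>e j\<close>; the complement does not contribute to \<open>h\<close>. Values in
  \<open>ennreal\<close> allow integration before integrability is known.\<close>

definition energy :: "'h \<Rightarrow> ennreal" where "energy v = (\<Sum>j. ennreal ((v \<bullet> e j)\<^sup>2))"

lemma h_nonneg: "0 \<le> h v"
  unfolding h_def by simp

text \<open>As a series of nonnegative terms, \<open>h\<close> is seen to be measurable and its
  expectation can be taken coordinate by coordinate.\<close>

lemma ennreal_h: "ennreal (h v) = (\<Sum>j. ennreal (lam j * (v \<bullet> e j)\<^sup>2))"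
  using second_moment_sums[of v] lam_nonneg
  by (subst suminf_ennreal2) (auto simp: h_def sums_iff)

lemma measurable_h[measurable]: "h \<in> borel_measurable borel"
proof -
  have "(\<lambda>v. enn2real (ennreal (h v))) \<in> borel_measurable borel"
    unfolding ennreal_h by measurable
  then show ?thesis by (simp add: h_nonneg)
qed

lemma measurable_energy[measurable]: "energy \<in> borel_measurable borel"
  unfolding energy_def by measurable

lemma measurable_grad[measurable (raw)]:
  assumes [measurable]: "f \<in> borel_measurable N" "g \<in> borel_measurable N"
  shows "(\<lambda>x. grad j (f x) (g x)) \<in> borel_measurable N"
proof -
  have "(\<lambda>p. grad j (fst p) (snd p)) \<in> borel_measurable borel"
    unfolding grad_def by (intro borel_measurable_continuous_onI continuous_intros)
  then have "(\<lambda>p. grad j (fst p) (snd p)) \<in> borel_measurable (borel \<Otimes>\<^sub>M borel)"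
    by (simp add: borel_prod)
  from measurable_compose[OF _ this, of "\<lambda>x. (f x, g x)" N] show ?thesis by simp
qed

lemma measurable_step[measurable (raw)]:
  assumes [measurable]: "f \<in> borel_measurable N" "g \<in> borel_measurable N"
  shows "(\<lambda>x. step (f x) (g x)) \<in> borel_measurable N"
proof -
  have "(\<lambda>p. step (fst p) (snd p)) \<in> borel_measurable borel"
    unfolding step_def by (intro borel_measurable_continuous_onI continuous_intros)
  then have "(\<lambda>p. step (fst p) (snd p)) \<in> borel_measurable (borel \<Otimes>\<^sub>M borel)"
    by (simp add: borel_prod)
  from measurable_compose[OF _ this, of "\<lambda>x. (f x, g x)" N] show ?thesis by simp
qed

lemma energy_eq: "summable (\<lambda>j. (v \<bullet> e j)\<^sup>2)" "energy v = ennreal (\<Sum>j. (v \<bullet> e j)\<^sup>2)"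
    "(\<Sum>j. (v \<bullet> e j)\<^sup>2) \<le> (norm v)\<^sup>2"
proof -
  have b: "(\<Sum>j<n. (v \<bullet> e j)\<^sup>2) \<le> (norm v)\<^sup>2" for n
    by (rule bessel_finite) (simp_all add: orthonormal)
  show s: "summable (\<lambda>j. (v \<bullet> e j)\<^sup>2)"
    by (rule summableI_nonneg_bounded[OF _ b]) simp
  then show "energy v = ennreal (\<Sum>j. (v \<bullet> e j)\<^sup>2)"
    unfolding energy_def by (subst suminf_ennreal2) auto
  show "(\<Sum>j. (v \<bullet> e j)\<^sup>2) \<le> (norm v)\<^sup>2"
    by (rule suminf_le_const[OF s b])
qed

lemma step_coordinate: "step v z \<bullet> e j = v \<bullet> e j - \<gamma> * grad j v z"
  by (simp add: step_def grad_def inner_diff_left inner_commute[of "fst z" "e j"])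

text \<open>The residual of the optimum is orthogonal to every coordinate and drops out in the mean,
  so the mean update multiplies coordinate \<open>j\<close> of the error by
  \<open>1 - \<gamma> * lam j\<close>.\<close>

lemma grad_mean:
  shows "integrable P (\<lambda>\<omega>. grad j v (X \<omega>, Y \<omega>))"
    and "(\<integral>\<omega>. grad j v (X \<omega>, Y \<omega>) \<partial>P) = lam j * (v \<bullet> e j)"
proof -
  have eq: "grad j v (X \<omega>, Y \<omega>)
      = (v \<bullet> X \<omega>) * (e j \<bullet> X \<omega>) - (Y \<omega> - ws \<bullet> X \<omega>) * (e j \<bullet> X \<omega>)" for \<omega>
    by (simp add: grad_def algebra_simps)
  have i: "integrable P (\<lambda>\<omega>. (v \<bullet> X \<omega>) * (e j \<bullet> X \<omega>))"
    by (intro integrable_mult_of_squares integrable_square) measurable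
  show "integrable P (\<lambda>\<omega>. grad j v (X \<omega>, Y \<omega>))"
    unfolding eq using i integrable_residual by simp
  show "(\<integral>\<omega>. grad j v (X \<omega>, Y \<omega>) \<partial>P) = lam j * (v \<bullet> e j)"
    unfolding eq using i integrable_residual by (simp add: covariance_eigen residual_orthogonal)
qed

text \<open>
  The energy estimate below needs a factor smaller than 2 in front of \<open>\<tau>\<close>, because only
  \<open>\<gamma> * \<tau> * suminf lam \<le> 1\<close> is known and the final constant may not depend on the slack.
\<close>

lemma grad_second_moment:
  shows "integrable P (\<lambda>\<omega>. (grad j v (X \<omega>, Y \<omega>))\<^sup>2)"
    and "(\<integral>\<omega>. (grad j v (X \<omega>, Y \<omega>))\<^sup>2 \<partial>P) \<le> lam j * (3/2 * \<tau> * h v + 3 * s)"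
proof -
  let ?a = "\<lambda>\<omega>. (v \<bullet> X \<omega>) * (e j \<bullet> X \<omega>)" and ?b = "\<lambda>\<omega>. (Y \<omega> - ws \<bullet> X \<omega>) * (e j \<bullet> X \<omega>)"
  have le: "(grad j v (X \<omega>, Y \<omega>))\<^sup>2 \<le> 3/2 * (?a \<omega>)\<^sup>2 + 3 * (?b \<omega>)\<^sup>2" for \<omega>
  proof -
    have "grad j v (X \<omega>, Y \<omega>) = ?a \<omega> - ?b \<omega>"
      by (simp add: grad_def algebra_simps)
    \<comment> \<open>Young's inequality with weights \<open>1 + 1/2\<close> and
      \<open>1 + 2\<close>; the gap is a multiple of a perfect square.\<close>
    moreover have "(a - b)\<^sup>2 \<le> 3/2 * a\<^sup>2 + 3 * b\<^sup>2" for a b :: real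
    proof -
      have "3/2 * a\<^sup>2 + 3 * b\<^sup>2 - (a - b)\<^sup>2 = (a + 2 * b)\<^sup>2 / 2"
        by (simp add: power2_eq_square algebra_simps)
      then show ?thesis
        using zero_le_power2[of "a + 2 * b"] by linarith
    qed
    ultimately show ?thesis by metis
  qed
  have i: "integrable P (\<lambda>\<omega>. 3/2 * (?a \<omega>)\<^sup>2 + 3 * (?b \<omega>)\<^sup>2)"
    using integrable_fourth integrable_noise by simp
  show int: "integrable P (\<lambda>\<omega>. (grad j v (X \<omega>, Y \<omega>))\<^sup>2)"
  proof (rule Bochner_Integration.integrable_bound[OF i])
    show "AE \<omega> in P. norm ((grad j v (X \<omega>, Y \<omega>))\<^sup>2) \<le> norm (3/2 * (?a \<omega>)\<^sup>2 + 3 * (?b \<omega>)\<^sup>2)"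
      using le by simp
  qed (simp add: grad_def)
  have "(\<integral>\<omega>. (grad j v (X \<omega>, Y \<omega>))\<^sup>2 \<partial>P) \<le> (\<integral>\<omega>. 3/2 * (?a \<omega>)\<^sup>2 + 3 * (?b \<omega>)\<^sup>2 \<partial>P)"
    using int i le by (rule integral_mono)
  also have "\<dots> = 3/2 * (\<integral>\<omega>. (?a \<omega>)\<^sup>2 \<partial>P) + 3 * (\<integral>\<omega>. (?b \<omega>)\<^sup>2 \<partial>P)"
    using integrable_fourth integrable_noise by simp
  also have "\<dots> \<le> 3/2 * (\<tau> * h v * lam j) + 3 * (s * lam j)"
    unfolding h_def by (intro add_mono mult_left_mono fourth_bound noise_bound) auto
  finally show "(\<integral>\<omega>. (grad j v (X \<omega>, Y \<omega>))\<^sup>2 \<partial>P) \<le> lam j * (3/2 * \<tau> * h v + 3 * s)"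
    by (simp add: algebra_simps)
qed

text \<open>After expanding the squares, the cross terms sum to a decrease of
  \<open>2 * \<gamma> * h v\<close>, while the second moments give back at most
  \<open>3/2 * \<gamma> * h v\<close> by \<open>gamma_tau\<close>. The margin
  \<open>\<gamma>/2 * h v\<close> stands on the left because subtraction in \<open>ennreal\<close>
  is truncated.\<close>

lemma energy_step:
  "(\<integral>\<^sup>+\<omega>. energy (step v (X \<omega>, Y \<omega>)) \<partial>P) + ennreal (\<gamma>/2 * h v)
    \<le> energy v + ennreal (3 * \<gamma>\<^sup>2 * s * suminf lam)"
proof -
  let ?K = "\<gamma>\<^sup>2 * (3/2 * \<tau> * h v + 3 * s)"
  let ?u = "\<lambda>j. (v \<bullet> e j)\<^sup>2 - 2 * \<gamma> * (lam j * (v \<bullet> e j)\<^sup>2) + ?K * lam j"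
  have coord: "integrable P (\<lambda>\<omega>. (step v (X \<omega>, Y \<omega>) \<bullet> e j)\<^sup>2)
      \<and> (\<integral>\<omega>. (step v (X \<omega>, Y \<omega>) \<bullet> e j)\<^sup>2 \<partial>P) \<le> ?u j" for j
  proof -
    let ?g = "\<lambda>\<omega>. grad j v (X \<omega>, Y \<omega>)"
    have eq: "(step v (X \<omega>, Y \<omega>) \<bullet> e j)\<^sup>2
        = (v \<bullet> e j)\<^sup>2 - 2 * \<gamma> * (v \<bullet> e j) * ?g \<omega> + \<gamma>\<^sup>2 * (?g \<omega>)\<^sup>2" for \<omega>
      by (simp add: step_coordinate power2_eq_square algebra_simps)
    have "(\<integral>\<omega>. (step v (X \<omega>, Y \<omega>) \<bullet> e j)\<^sup>2 \<partial>P)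
        = (v \<bullet> e j)\<^sup>2 - 2 * \<gamma> * (v \<bullet> e j) * (lam j * (v \<bullet> e j)) + \<gamma>\<^sup>2 * (\<integral>\<omega>. (?g \<omega>)\<^sup>2 \<partial>P)"
      unfolding eq using grad_mean grad_second_moment(1) by (simp add: prob_space)
    also have "\<dots> \<le> (v \<bullet> e j)\<^sup>2 - 2 * \<gamma> * (v \<bullet> e j) * (lam j * (v \<bullet> e j))
        + \<gamma>\<^sup>2 * (lam j * (3/2 * \<tau> * h v + 3 * s))"
      by (intro add_left_mono mult_left_mono grad_second_moment) simp
    finally have "(\<integral>\<omega>. (step v (X \<omega>, Y \<omega>) \<bullet> e j)\<^sup>2 \<partial>P) \<le> ?u j"
      by (simp add: power2_eq_square mult_ac)
    moreover have "integrable P (\<lambda>\<omega>. (step v (X \<omega>, Y \<omega>) \<bullet> e j)\<^sup>2)"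
      unfolding eq using grad_mean grad_second_moment(1) by simp
    ultimately show ?thesis by simp
  qed
  \<comment> \<open>\<open>?u j\<close> dominates a nonnegative integral; its sign allows the real
    series to be transferred to \<open>ennreal\<close>.\<close>
  have u_nonneg: "0 \<le> ?u j" for j
  proof -
    have "0 \<le> (\<integral>\<omega>. (step v (X \<omega>, Y \<omega>) \<bullet> e j)\<^sup>2 \<partial>P)" by simp
    with coord[of j] show ?thesis by linarith
  qed
  have h: "(\<lambda>j. lam j * (v \<bullet> e j)\<^sup>2) sums h v"
    using second_moment_sums by (simp add: h_def)
  have u_sums: "?u sums ((\<Sum>j. (v \<bullet> e j)\<^sup>2) - 2 * \<gamma> * h v + ?K * suminf lam)"
    by (intro sums_add sums_diff sums_mult h summable_sums energy_eq summable_lam)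
  have "(\<integral>\<^sup>+\<omega>. energy (step v (X \<omega>, Y \<omega>)) \<partial>P)
      = (\<Sum>j. \<integral>\<^sup>+\<omega>. ennreal ((step v (X \<omega>, Y \<omega>) \<bullet> e j)\<^sup>2) \<partial>P)"
    unfolding energy_def by (rule nn_integral_suminf) (simp add: step_def)
  also have "\<dots> \<le> (\<Sum>j. ennreal (?u j))"
  proof (intro suminf_le summableI)
    fix j
    have "(\<integral>\<^sup>+\<omega>. ennreal ((step v (X \<omega>, Y \<omega>) \<bullet> e j)\<^sup>2) \<partial>P)
        = ennreal (\<integral>\<omega>. (step v (X \<omega>, Y \<omega>) \<bullet> e j)\<^sup>2 \<partial>P)"
      using coord[of j] by (intro nn_integral_eq_integral) auto
    also have "\<dots> \<le> ennreal (?u j)"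
      using coord[of j] by (intro ennreal_leI) simp
    finally show "(\<integral>\<^sup>+\<omega>. ennreal ((step v (X \<omega>, Y \<omega>) \<bullet> e j)\<^sup>2) \<partial>P) \<le> ennreal (?u j)" .
  qed
  also have "\<dots> = ennreal ((\<Sum>j. (v \<bullet> e j)\<^sup>2) - 2 * \<gamma> * h v + ?K * suminf lam)"
    using u_sums u_nonneg by (subst suminf_ennreal2) (auto simp: sums_iff)
  finally have "(\<integral>\<^sup>+\<omega>. energy (step v (X \<omega>, Y \<omega>)) \<partial>P) + ennreal (\<gamma>/2 * h v)
      \<le> ennreal ((\<Sum>j. (v \<bullet> e j)\<^sup>2) - 2 * \<gamma> * h v + ?K * suminf lam) + ennreal (\<gamma>/2 * h v)"
    by (rule add_right_mono)
  also have "\<dots> = ennreal ((\<Sum>j. (v \<bullet> e j)\<^sup>2) - 2 * \<gamma> * h v + ?K * suminf lam + \<gamma>/2 * h v)"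
  proof (rule ennreal_plus[symmetric])
    show "0 \<le> (\<Sum>j. (v \<bullet> e j)\<^sup>2) - 2 * \<gamma> * h v + ?K * suminf lam"
      using u_sums u_nonneg by (metis (no_types, lifting) suminf_nonneg sums_iff)
    show "0 \<le> \<gamma>/2 * h v" using gamma_pos h_nonneg by simp
  qed
  also have "\<dots> \<le> ennreal ((\<Sum>j. (v \<bullet> e j)\<^sup>2) + 3 * \<gamma>\<^sup>2 * s * suminf lam)"
  proof (rule ennreal_leI)
    have "?K * suminf lam = 3/2 * \<gamma> * h v * (\<gamma> * \<tau> * suminf lam) + 3 * \<gamma>\<^sup>2 * s * suminf lam"
      by (simp add: power2_eq_square algebra_simps)
    also have "\<dots> \<le> 3/2 * \<gamma> * h v * 1 + 3 * \<gamma>\<^sup>2 * s * suminf lam"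
      using gamma_tau gamma_pos h_nonneg by (intro add_right_mono mult_left_mono) auto
    finally show "(\<Sum>j. (v \<bullet> e j)\<^sup>2) - 2 * \<gamma> * h v + ?K * suminf lam + \<gamma>/2 * h v
        \<le> (\<Sum>j. (v \<bullet> e j)\<^sup>2) + 3 * \<gamma>\<^sup>2 * s * suminf lam"
      by linarith
  qed
  also have "\<dots> = energy v + ennreal (3 * \<gamma>\<^sup>2 * s * suminf lam)"
    unfolding energy_eq using s_nonneg lam_nonneg
    by (intro ennreal_plus suminf_nonneg energy_eq summable_lam mult_nonneg_nonneg) auto
  finally show ?thesis .
qed

section \<open>Errors along the sample paths\<close>


text \<open>The centred gradient with reversed sign, so that coordinate \<open>j\<close> of the
  error obeys \<open>a' = (1 - \<gamma> * lam j) * a + \<gamma> * noise\<close>.\<close>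

definition noise :: "nat \<Rightarrow> 'h \<Rightarrow> 'h \<times> real \<Rightarrow> real" where
  "noise j v z = lam j * (v \<bullet> e j) - grad j v z"

lemma measurable_noise[measurable (raw)]:
  assumes [measurable]: "f \<in> borel_measurable N" "g \<in> borel_measurable N"
  shows "(\<lambda>x. noise j (f x) (g x)) \<in> borel_measurable N"
  unfolding noise_def by measurable

lemma noise_mean: "(\<integral>\<omega>. noise j v (X \<omega>, Y \<omega>) \<partial>P) = 0"
  unfolding noise_def using grad_mean by (simp add: prob_space)

text \<open>A variance is at most the second moment, so centring costs nothing.\<close>

lemma noise_second_moment:
  "(\<integral>\<^sup>+\<omega>. ennreal ((noise j v (X \<omega>, Y \<omega>))\<^sup>2) \<partial>P) \<le> ennreal (lam j * (3/2 * \<tau> * h v + 3 * s))"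
proof -
  let ?g = "\<lambda>\<omega>. grad j v (X \<omega>, Y \<omega>)" and ?m = "lam j * (v \<bullet> e j)"
  have eq: "(noise j v (X \<omega>, Y \<omega>))\<^sup>2 = ?m\<^sup>2 - 2 * ?m * ?g \<omega> + (?g \<omega>)\<^sup>2" for \<omega>
    by (simp add: noise_def power2_diff)
  have "(\<integral>\<omega>. (noise j v (X \<omega>, Y \<omega>))\<^sup>2 \<partial>P) = (\<integral>\<omega>. (?g \<omega>)\<^sup>2 \<partial>P) - ?m\<^sup>2"
    unfolding eq using grad_mean grad_second_moment(1) by (simp add: prob_space power2_eq_square)
  also have "\<dots> \<le> lam j * (3/2 * \<tau> * h v + 3 * s)"
    using grad_second_moment(2)[of j v] zero_le_power2[of ?m] by linarith
  finally have "(\<integral>\<omega>. (noise j v (X \<omega>, Y \<omega>))\<^sup>2 \<partial>P) \<le> lam j * (3/2 * \<tau> * h v + 3 * s)" .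
  moreover have "integrable P (\<lambda>\<omega>. (noise j v (X \<omega>, Y \<omega>))\<^sup>2)"
    unfolding eq using grad_mean grad_second_moment(1) by simp
  ultimately show ?thesis
    by (simp add: nn_integral_eq_integral ennreal_leI)
qed

text \<open>Defined on data arrays, indexed by node and time, rather than on sample points. This
  makes it expressible on which entries an iterate depends.\<close>

definition err :: "(nat \<times> nat \<Rightarrow> 'h \<times> real) \<Rightarrow> nat \<Rightarrow> nat \<Rightarrow> 'h" where
  "err w m t = sgd \<gamma> 0 (\<lambda>t. w (m, t)) t - ws"

lemma err_simps: "err w m 0 = - ws" "err w m (Suc t) = step (err w m t) (w (m, t))"
  by (simp_all add: err_def step_def inner_diff_left algebra_simps)

lemma err_cong:
  assumes "\<And>u. u < t \<Longrightarrow> w (m, u) = w' (m, u)"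
  shows "err w m t = err w' m t"
  using assms by (induction t) (simp_all add: err_simps)

text \<open>This takes the place of adaptedness to a filtration: the error at time \<open>t\<close>
  factors measurably through the entries of node \<open>m\<close> before \<open>t\<close>.\<close>

lemma measurable_err:
  assumes "\<And>u. u < t \<Longrightarrow> (m, u) \<in> J"
  shows "(\<lambda>w. err w m t) \<in> borel_measurable (PiM J (\<lambda>_. borel))"
  using assms
proof (induction t)
  case (Suc t)
  then have [measurable]: "(\<lambda>w. err w m t) \<in> borel_measurable (PiM J (\<lambda>_. borel))"
      "(\<lambda>w. w (m, t)) \<in> measurable (PiM J (\<lambda>_. borel)) borel"
    by (auto intro: measurable_component_singleton[of _ _ "\<lambda>_. borel"])
  show ?case unfolding err_simps by measurable
qed (simp add: err_simps)

end

section \<open>Independence of one data point from all others\<close>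

locale sgd_sample = least_squares P X Y ws e lam \<tau> s \<gamma>
  for P :: "'w measure" and X :: "'w \<Rightarrow> 'h::{real_inner, banach, second_countable_topology}"
    and Y ws e lam \<tau> s \<gamma> +
  fixes M T :: nat and Z :: "nat \<times> nat \<Rightarrow> 'w \<Rightarrow> 'h \<times> real"
  assumes indep: "indep_vars (\<lambda>_. borel) Z ({..<M} \<times> {..<T})"
    and Z_distr: "i \<in> {..<M} \<times> {..<T} \<Longrightarrow> distr P borel (Z i) = distr P borel (\<lambda>\<omega>. (X \<omega>, Y \<omega>))"
begin

abbreviation I :: "(nat \<times> nat) set" where "I \<equiv> {..<M} \<times> {..<T}"

abbreviation (input) path :: "'w \<Rightarrow> nat \<times> nat \<Rightarrow> 'h \<times> real" where "path \<omega> \<equiv> (\<lambda>i. Z i \<omega>)"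

text \<open>Past, future and the other nodes are kept together, so that a single kind of
  conditioning serves all orthogonality relations.\<close>

definition others :: "nat \<times> nat \<Rightarrow> 'w \<Rightarrow> nat \<times> nat \<Rightarrow> 'h \<times> real" where
  "others i \<omega> = restrict (path \<omega>) (I - {i})"

lemma measurable_Z: "i \<in> I \<Longrightarrow> Z i \<in> borel_measurable P"
  using indep by (auto simp: indep_vars_def)

lemma measurable_others: "others i \<in> measurable P (PiM (I - {i}) (\<lambda>_. borel))"
  unfolding others_def using measurable_Z by (intro measurable_restrict) auto

lemma measurable_XY: "(\<lambda>\<omega>. (X \<omega>, Y \<omega>)) \<in> borel_measurable P"
  by simp

text \<open>Grouping independent variables yields families over index subsets, so \<open>Z i\<close>
  first appears as the family over \<open>{i}\<close>, of the same type as \<open>others i\<close>.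
  Evaluation at \<open>i\<close> then transports the product law.\<close>

lemma indep_others:
  assumes i: "i \<in> I"
  shows "distr P (PiM (I - {i}) (\<lambda>_. borel) \<Otimes>\<^sub>M borel) (\<lambda>\<omega>. (others i \<omega>, Z i \<omega>))
    = distr P (PiM (I - {i}) (\<lambda>_. borel)) (others i) \<Otimes>\<^sub>M distr P borel (Z i)"
proof -
  let ?N = "PiM (I - {i}) (\<lambda>_. borel :: ('h \<times> real) measure)" and ?K = "PiM {i} (\<lambda>_. borel :: ('h \<times> real) measure)"
  let ?U = "\<lambda>\<omega>. restrict (path \<omega>) {i}"
  note [measurable] = measurable_others[of i] measurable_Z[OF i]
  have [measurable]: "?U \<in> measurable P ?K" by (intro measurable_restrict) simp
  have [measurable]: "(\<lambda>w. w i) \<in> measurable ?K borel"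
    by (rule measurable_component_singleton) simp
  have "indep_var ?N (others i) ?K ?U"
    unfolding others_def using i by (intro indep_var_restrict[OF indep]) auto
  then have joint: "distr P ?N (others i) \<Otimes>\<^sub>M distr P ?K ?U = distr P (?N \<Otimes>\<^sub>M ?K) (\<lambda>\<omega>. (others i \<omega>, ?U \<omega>))"
    by (simp add: indep_var_distribution_eq)
  have Zi: "distr (distr P ?K ?U) borel (\<lambda>w. w i) = distr P borel (Z i)"
    by (simp add: distr_distr comp_def)
  have "distr P ?N (others i) \<Otimes>\<^sub>M distr P borel (Z i)
      = distr (distr P ?N (others i)) ?N (\<lambda>w. w) \<Otimes>\<^sub>M distr (distr P ?K ?U) borel (\<lambda>w. w i)"
    unfolding Zi by (simp add: distr_distr comp_def)
  also have "\<dots> = distr (distr P ?N (others i) \<Otimes>\<^sub>M distr P ?K ?U) (?N \<Otimes>\<^sub>M borel) (\<lambda>(w, u). (w, u i))"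
    unfolding Zi
    by (subst Zi[symmetric], rule pair_measure_distr)
      (auto simp: Zi intro!: prob_space_imp_sigma_finite prob_space_distr)
  also have "\<dots> = distr P (?N \<Otimes>\<^sub>M borel) (\<lambda>\<omega>. (others i \<omega>, Z i \<omega>))"
    unfolding joint by (subst distr_distr) (simp_all add: comp_def)
  finally show ?thesis ..
qed

text \<open>Conditioning on all other data: \<open>Z i\<close> is replaced by a fresh copy of the
  reference pair.\<close>

lemma others_nn_integral:
  assumes "i \<in> I" "f \<in> borel_measurable (PiM (I - {i}) (\<lambda>_. borel) \<Otimes>\<^sub>M borel)"
  shows "(\<integral>\<^sup>+\<omega>. f (others i \<omega>, Z i \<omega>) \<partial>P) = (\<integral>\<^sup>+\<omega>. \<integral>\<^sup>+\<omega>'. f (others i \<omega>, (X \<omega>', Y \<omega>')) \<partial>P \<partial>P)"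
  by (rule indep_nn_integral_pair[OF measurable_others measurable_Z[OF assms(1)] measurable_XY
      indep_others[OF assms(1)] Z_distr[OF assms(1)] assms(2)])

lemma others_integral:
  fixes f :: "_ \<Rightarrow> real"
  assumes "i \<in> I" "f \<in> borel_measurable (PiM (I - {i}) (\<lambda>_. borel) \<Otimes>\<^sub>M borel)"
    and "integrable P (\<lambda>\<omega>. f (others i \<omega>, Z i \<omega>))"
  shows "(\<integral>\<omega>. f (others i \<omega>, Z i \<omega>) \<partial>P) = (\<integral>\<omega>. \<integral>\<omega>'. f (others i \<omega>, (X \<omega>', Y \<omega>')) \<partial>P \<partial>P)"
  by (rule indep_integral_pair[OF measurable_others measurable_Z[OF assms(1)] measurable_XY
      indep_others[OF assms(1)] Z_distr[OF assms(1)] assms(2,3)])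

text \<open>The iterate at time \<open>snd i\<close> of node \<open>fst i\<close> has not yet
  consumed data point \<open>i\<close>, and the other nodes never do.\<close>

lemma err_others:
  assumes "m < M" "t \<le> T" "m \<noteq> fst i \<or> t \<le> snd i"
  shows "err (others i \<omega>) m t = err (path \<omega>) m t"
  using assms by (intro err_cong) (auto simp: others_def prod_eq_iff)

lemma measurable_err_others:
  assumes "m < M" "t \<le> T" "m \<noteq> fst i \<or> t \<le> snd i"
  shows "(\<lambda>w. err w m t) \<in> borel_measurable (PiM (I - {i}) (\<lambda>_. borel))"
  using assms by (intro measurable_err) (auto simp: prod_eq_iff)

lemma measurable_err_path:
  assumes "m < M" "t \<le> T"
  shows "(\<lambda>\<omega>. err (path \<omega>) m t) \<in> borel_measurable P"
  \<comment> \<open>The index \<open>(m, T)\<close> lies outside \<open>I\<close>, so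
    \<open>others (m, T)\<close> retains the whole sample.\<close>
  using measurable_compose[OF measurable_others measurable_err_others, of m t "(m, T)"] assms
  by (simp add: err_others)

section \<open>The descent inequality along one node\<close>

definition hbar :: "nat \<Rightarrow> nat \<Rightarrow> ennreal" where
  "hbar m t = (\<integral>\<^sup>+\<omega>. ennreal (h (err (path \<omega>) m t)) \<partial>P)"

text \<open>The current error is a function of the other data, so \<open>energy_step\<close> applies
  under the outer integral with this error frozen.\<close>

lemma energy_path_step:
  assumes "m < M" "t < T"
  shows "(\<integral>\<^sup>+\<omega>. energy (err (path \<omega>) m (Suc t)) \<partial>P) + ennreal (\<gamma>/2) * hbar m t
    \<le> (\<integral>\<^sup>+\<omega>. energy (err (path \<omega>) m t) \<partial>P) + ennreal (3 * \<gamma>\<^sup>2 * s * suminf lam)"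
proof -
  let ?i = "(m, t)"
  note [measurable] = measurable_err_path[of m t] measurable_err_others[of m t ?i]
  have i: "?i \<in> I" using assms by simp
  have e: "err (others ?i \<omega>) m t = err (path \<omega>) m t" for \<omega>
    using assms by (intro err_others) auto
  have "(\<integral>\<^sup>+\<omega>. energy (err (path \<omega>) m (Suc t)) \<partial>P)
      = (\<integral>\<^sup>+\<omega>. (\<lambda>(w, z). energy (step (err w m t) z)) (others ?i \<omega>, Z ?i \<omega>) \<partial>P)"
    by (simp add: err_simps e)
  also have "\<dots> = (\<integral>\<^sup>+\<omega>. \<integral>\<^sup>+\<omega>'. energy (step (err (path \<omega>) m t) (X \<omega>', Y \<omega>')) \<partial>P \<partial>P)"
    using assms by (subst others_nn_integral[OF i]) (auto simp: e)
  finally have "(\<integral>\<^sup>+\<omega>. energy (err (path \<omega>) m (Suc t)) \<partial>P) + ennreal (\<gamma>/2) * hbar m t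
      = (\<integral>\<^sup>+\<omega>. (\<integral>\<^sup>+\<omega>'. energy (step (err (path \<omega>) m t) (X \<omega>', Y \<omega>')) \<partial>P)
          + ennreal (\<gamma>/2 * h (err (path \<omega>) m t)) \<partial>P)"
    using assms gamma_pos h_nonneg unfolding hbar_def
    by (subst nn_integral_add) (simp_all add: ennreal_mult nn_integral_cmult del: times_divide_eq_left)
  also have "\<dots> \<le> (\<integral>\<^sup>+\<omega>. energy (err (path \<omega>) m t) + ennreal (3 * \<gamma>\<^sup>2 * s * suminf lam) \<partial>P)"
    by (intro nn_integral_mono energy_step)
  also have "\<dots> = (\<integral>\<^sup>+\<omega>. energy (err (path \<omega>) m t) \<partial>P) + ennreal (3 * \<gamma>\<^sup>2 * s * suminf lam)"
    using assms by (subst nn_integral_add) (auto simp: emeasure_space_1)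
  finally show ?thesis .
qed

lemma suminf_lam_nonneg: "0 \<le> suminf lam"
  using summable_lam lam_nonneg by (rule suminf_nonneg)

text \<open>Telescoping of the one step inequality. The energy stays on the left to carry the
  induction; at time 0 the error is \<open>- ws\<close>, as the iteration starts at 0.\<close>

lemma energy_path_sum:
  assumes "m < M" "n \<le> T"
  shows "(\<integral>\<^sup>+\<omega>. energy (err (path \<omega>) m n) \<partial>P) + ennreal (\<gamma>/2) * (\<Sum>t<n. hbar m t)
    \<le> ennreal ((norm ws)\<^sup>2 + real n * (3 * \<gamma>\<^sup>2 * s * suminf lam))"
  using assms(2)
proof (induction n)
  case 0
  have "energy (- ws) \<le> ennreal ((norm ws)\<^sup>2)"
    using energy_eq[of "- ws"] by (simp add: ennreal_leI)
  then show ?case by (simp add: err_simps emeasure_space_1)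
next
  case (Suc n)
  let ?E = "\<lambda>n. \<integral>\<^sup>+\<omega>. energy (err (path \<omega>) m n) \<partial>P" and ?K = "3 * \<gamma>\<^sup>2 * s * suminf lam"
  have K: "0 \<le> ?K" using s_nonneg suminf_lam_nonneg by simp
  have "?E (Suc n) + ennreal (\<gamma>/2) * (\<Sum>t<Suc n. hbar m t)
      = (?E (Suc n) + ennreal (\<gamma>/2) * hbar m n) + ennreal (\<gamma>/2) * (\<Sum>t<n. hbar m t)"
    by (simp add: distrib_left add_ac)
  also have "\<dots> \<le> (?E n + ennreal ?K) + ennreal (\<gamma>/2) * (\<Sum>t<n. hbar m t)"
    using assms Suc.prems by (intro add_right_mono energy_path_step) auto
  also have "\<dots> = (?E n + ennreal (\<gamma>/2) * (\<Sum>t<n. hbar m t)) + ennreal ?K"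
    by (simp add: add_ac)
  also have "\<dots> \<le> ennreal ((norm ws)\<^sup>2 + real n * ?K) + ennreal ?K"
    using Suc by (intro add_right_mono) auto
  also have "\<dots> = ennreal ((norm ws)\<^sup>2 + real n * ?K + ?K)"
    using K by (intro ennreal_plus[symmetric] add_nonneg_nonneg mult_nonneg_nonneg[OF _ K]) auto
  also have "(norm ws)\<^sup>2 + real n * ?K + ?K = (norm ws)\<^sup>2 + real (Suc n) * ?K"
    by (simp add: algebra_simps)
  finally show ?case .
qed

text \<open>The final energy is dropped and the factor \<open>\<gamma>/2\<close> divided out.
  Besides its size, the bound supplies the finiteness that makes the fluctuations square
  integrable.\<close>

lemma hbar_sum:
  assumes "m < M"
  shows "(\<Sum>t<T. hbar m t) \<le> ennreal (2/\<gamma> * ((norm ws)\<^sup>2 + real T * (3 * \<gamma>\<^sup>2 * s * suminf lam)))"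
proof -
  let ?B = "(norm ws)\<^sup>2 + real T * (3 * \<gamma>\<^sup>2 * s * suminf lam)"
  have "(\<Sum>t<T. hbar m t) = ennreal (2/\<gamma>) * (ennreal (\<gamma>/2) * (\<Sum>t<T. hbar m t))"
    using gamma_pos by (simp add: mult.assoc[symmetric] ennreal_mult[symmetric])
  also have "\<dots> \<le> ennreal (2/\<gamma>) * ennreal ?B"
    using energy_path_sum[OF assms order_refl] by (intro mult_left_mono) (auto intro: order_trans[rotated])
  also have "\<dots> = ennreal (2/\<gamma> * ?B)"
    using gamma_pos s_nonneg suminf_lam_nonneg by (intro ennreal_mult[symmetric]) auto
  finally show ?thesis .
qed

section \<open>Fluctuations as martingale differences\<close>

definition fluct :: "nat \<Rightarrow> nat \<times> nat \<Rightarrow> 'w \<Rightarrow> real" where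
  "fluct j i \<omega> = noise j (err (path \<omega>) (fst i) (snd i)) (Z i \<omega>)"

lemma measurable_fluct: "i \<in> I \<Longrightarrow> fluct j i \<in> borel_measurable P"
  unfolding fluct_def
  by (intro measurable_noise measurable_err_path measurable_Z) auto

lemma fluct_second_moment:
  assumes i: "i \<in> I"
  shows "(\<integral>\<^sup>+\<omega>. ennreal ((fluct j i \<omega>)\<^sup>2) \<partial>P)
    \<le> ennreal (lam j) * (ennreal (3/2 * \<tau>) * hbar (fst i) (snd i) + ennreal (3 * s))"
proof -
  let ?e = "\<lambda>\<omega>. err (path \<omega>) (fst i) (snd i)"
  have i': "fst i < M" "snd i < T" using i by auto
  note [measurable] = measurable_err_path[of "fst i" "snd i"] measurable_err_others[of "fst i" "snd i" i]
  have e: "err (others i \<omega>) (fst i) (snd i) = ?e \<omega>" for \<omega>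
    using i' by (intro err_others) auto
  have "(\<integral>\<^sup>+\<omega>. ennreal ((fluct j i \<omega>)\<^sup>2) \<partial>P)
      = (\<integral>\<^sup>+\<omega>. (\<lambda>(w, z). ennreal ((noise j (err w (fst i) (snd i)) z)\<^sup>2)) (others i \<omega>, Z i \<omega>) \<partial>P)"
    by (simp add: fluct_def e)
  also have "\<dots> = (\<integral>\<^sup>+\<omega>. \<integral>\<^sup>+\<omega>'. ennreal ((noise j (?e \<omega>) (X \<omega>', Y \<omega>'))\<^sup>2) \<partial>P \<partial>P)"
    using i' by (subst others_nn_integral[OF i]) (auto simp: e)
  also have "\<dots> \<le> (\<integral>\<^sup>+\<omega>. ennreal (lam j * (3/2 * \<tau> * h (?e \<omega>) + 3 * s)) \<partial>P)"
    by (intro nn_integral_mono noise_second_moment)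
  also have "\<dots> = (\<integral>\<^sup>+\<omega>. ennreal (lam j) * (ennreal (3/2 * \<tau>) * ennreal (h (?e \<omega>)) + ennreal (3 * s)) \<partial>P)"
    using lam_nonneg tau_nonneg s_nonneg h_nonneg
    by (intro nn_integral_cong) (simp add: ennreal_mult[symmetric] ennreal_plus[symmetric] del: ennreal_plus)
  also have "\<dots> = ennreal (lam j) * (ennreal (3/2 * \<tau>) * hbar (fst i) (snd i) + ennreal (3 * s))"
    using i' unfolding hbar_def
    by (simp add: nn_integral_cmult nn_integral_add emeasure_space_1)
  finally show ?thesis .
qed

lemma hbar_finite:
  assumes "m < M" "t < T"
  shows "hbar m t < \<infinity>"
proof -
  have "hbar m t \<le> (\<Sum>t<T. hbar m t)"
    using assms by (intro member_le_sum) auto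
  also have "\<dots> < \<infinity>"
    using hbar_sum[OF assms(1)] by (rule order_le_less_trans) simp
  finally show ?thesis .
qed

lemma integrable_fluct_square:
  assumes i: "i \<in> I"
  shows "integrable P (\<lambda>\<omega>. (fluct j i \<omega>)\<^sup>2)"
proof (rule integrableI_bounded)
  show "(\<lambda>\<omega>. (fluct j i \<omega>)\<^sup>2) \<in> borel_measurable P"
    using measurable_fluct[OF i] by simp
  have "(\<integral>\<^sup>+\<omega>. ennreal ((fluct j i \<omega>)\<^sup>2) \<partial>P) < \<infinity>"
    using i hbar_finite[of "fst i" "snd i"]
    by (intro order_le_less_trans[OF fluct_second_moment]) (auto simp: ennreal_mult_less_top)
  then show "(\<integral>\<^sup>+\<omega>. ennreal (norm ((fluct j i \<omega>)\<^sup>2)) \<partial>P) < \<infinity>" by simp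
qed

text \<open>With all other data frozen, \<open>G\<close> and the current error are constants, and
  the inner expectation is a multiple of the mean of \<open>noise\<close>, which is 0.\<close>

lemma fluct_mean_weighted:
  assumes i: "i \<in> I" and G: "G \<in> borel_measurable (PiM (I - {i}) (\<lambda>_. borel))"
    and int: "integrable P (\<lambda>\<omega>. G (others i \<omega>) * fluct j i \<omega>)"
  shows "(\<integral>\<omega>. G (others i \<omega>) * fluct j i \<omega> \<partial>P) = 0"
proof -
  have i': "fst i < M" "snd i < T" using i by auto
  note [measurable] = G measurable_err_others[of "fst i" "snd i" i]
  have e: "err (others i \<omega>) (fst i) (snd i) = err (path \<omega>) (fst i) (snd i)" for \<omega>
    using i' by (intro err_others) auto
  let ?f = "\<lambda>(w, z). G w * noise j (err w (fst i) (snd i)) z"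
  have eq: "G (others i \<omega>) * fluct j i \<omega> = ?f (others i \<omega>, Z i \<omega>)" for \<omega>
    by (simp add: fluct_def e)
  have "(\<integral>\<omega>. ?f (others i \<omega>, Z i \<omega>) \<partial>P) = (\<integral>\<omega>. \<integral>\<omega>'. ?f (others i \<omega>, (X \<omega>', Y \<omega>')) \<partial>P \<partial>P)"
    using i' int unfolding eq by (intro others_integral[OF i]) auto
  also have "\<dots> = 0"
    by (simp add: noise_mean)
  finally show ?thesis unfolding eq .
qed

lemma fluct_mean: "i \<in> I \<Longrightarrow> (\<integral>\<omega>. fluct j i \<omega> \<partial>P) = 0"
  using fluct_mean_weighted[of i "\<lambda>_. 1" j]
    integrable_of_square[OF measurable_fluct integrable_fluct_square, of i j] by simp

text \<open>Of two distinct data points, one does not enter the fluctuation at the other: the later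
  one on a common node, either one on different nodes. The fluctuation at the other point is then an
  admissible weight in \<open>fluct_mean_weighted\<close>.\<close>

lemma fluct_orthogonal:
  assumes "i \<in> I" "k \<in> I" "i \<noteq> k"
  shows "(\<integral>\<omega>. fluct j i \<omega> * fluct j k \<omega> \<partial>P) = 0"
proof -
  have *: "(\<integral>\<omega>. fluct j k \<omega> * fluct j i \<omega> \<partial>P) = 0"
    if i: "i \<in> I" and k: "k \<in> I" and ne: "i \<noteq> k" and le: "fst k \<noteq> fst i \<or> snd k \<le> snd i" for i k
  proof -
    let ?G = "\<lambda>w. noise j (err w (fst k) (snd k)) (w k)"
    have k': "fst k < M" "snd k \<le> T" using k by auto
    have G: "?G \<in> borel_measurable (PiM (I - {i}) (\<lambda>_. borel))"
      using k ne k' le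
      by (intro measurable_noise measurable_err_others measurable_component_singleton[of _ _ "\<lambda>_. borel"]) auto
    have eq: "?G (others i \<omega>) = fluct j k \<omega>" for \<omega>
      using err_others[OF k' le] k ne by (simp add: fluct_def others_def)
    have "integrable P (\<lambda>\<omega>. fluct j k \<omega> * fluct j i \<omega>)"
      using i k by (auto intro!: integrable_mult_of_squares[OF measurable_fluct measurable_fluct
            integrable_fluct_square integrable_fluct_square])
    then show ?thesis
      using fluct_mean_weighted[OF i G, of j] unfolding eq by simp
  qed
  show ?thesis
  \<comment> \<open>If the condition fails, \<open>k\<close> is the later point on the same node and
    the roles are exchanged.\<close>
  proof (cases "fst k \<noteq> fst i \<or> snd k \<le> snd i")
    case True
    then show ?thesis using *[of i k] assms by (simp add: mult.commute)
  next
    case False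
    then show ?thesis using *[of k i] assms by simp
  qed
qed

section \<open>The averaged error\<close>


definition avg_err :: "'w \<Rightarrow> 'h" where
  "avg_err \<omega> = (1 / real M) *\<^sub>R (\<Sum>m<M. (1 / real T) *\<^sub>R (\<Sum>t<T. err (path \<omega>) m t))"

lemma distributed_sgd_minus_optimum:
  assumes "0 < M" "0 < T" "n div M = T"
  shows "distributed_sgd \<gamma> 0 M n (\<lambda>m t. Z (m, t) \<omega>) - ws = avg_err \<omega>"
  using assms
  by (simp add: avg_err_def distributed_sgd_def sgd_average_def err_def sum_subtractf
      scaleR_right_diff_distrib scaleR_sum_right[symmetric] sum_constant_scaleR)

text \<open>The total weight that a unit perturbation of coordinate \<open>j\<close> receives over
  \<open>n\<close> consecutive iterates.\<close>

definition geo :: "nat \<Rightarrow> nat \<Rightarrow> real" where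
  "geo j n = (\<Sum>k<n. (1 - \<gamma> * lam j) ^ k)"

lemma geo_bounds:
  "0 \<le> geo j n" "geo j n \<le> real n" "\<gamma> * lam j * geo j n \<le> 1"
  using geometric_sum_bounds[of "\<gamma> * lam j" n] lam_nonneg[of j] lam_le_1[of j] gamma_pos gamma_le_1
  by (auto simp: geo_def mult_le_one)

text \<open>All nodes start from the same error, so the bias does not shrink with \<open>M\<close>,
  whereas each fluctuation carries a factor \<open>1 / M\<close>.\<close>

lemma avg_err_coordinate:
  assumes "0 < M"
  shows "avg_err \<omega> \<bullet> e j = - (ws \<bullet> e j) * geo j T / real T
    + (\<Sum>i\<in>I. \<gamma> / (real M * real T) * geo j (T - 1 - snd i) * fluct j i \<omega>)"
proof -
  have rec: "(\<Sum>t<T. err (path \<omega>) m t \<bullet> e j)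
      = - (ws \<bullet> e j) * geo j T + \<gamma> * (\<Sum>t<T. geo j (T - 1 - t) * fluct j (m, t) \<omega>)" for m
    using sum_affine_recurrence[of "\<lambda>t. err (path \<omega>) m t \<bullet> e j" "1 - \<gamma> * lam j" \<gamma> "\<lambda>t. fluct j (m, t) \<omega>" T]
    by (simp add: err_simps step_coordinate fluct_def noise_def geo_def algebra_simps)
  have "avg_err \<omega> \<bullet> e j = (\<Sum>m<M. (\<Sum>t<T. err (path \<omega>) m t \<bullet> e j) / (real M * real T))"
    by (simp add: avg_err_def inner_sum_left sum_divide_distrib mult.commute[of "real T"])
  also have "\<dots> = (\<Sum>m<M. - (ws \<bullet> e j) * geo j T / (real M * real T)
      + (\<Sum>t<T. \<gamma> / (real M * real T) * geo j (T - 1 - t) * fluct j (m, t) \<omega>))"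
    unfolding rec by (simp only: add_divide_distrib sum_distrib_left sum_divide_distrib times_divide_eq_left mult.assoc)
  also have "\<dots> = - (ws \<bullet> e j) * geo j T / real T
      + (\<Sum>m<M. \<Sum>t<T. \<gamma> / (real M * real T) * geo j (T - 1 - t) * fluct j (m, t) \<omega>)"
    using assms by (subst sum.distrib) simp
  finally show ?thesis
    by (simp add: sum.cartesian_product split_beta')
qed

section \<open>Effective dimension and the bound on the excess risk\<close>

definition eff_dim_term :: "nat \<Rightarrow> real" where
  "eff_dim_term j = (min 1 (lam j * real T))\<^sup>2"

text \<open>Both bounds on the geometric sum at once. Since \<open>\<gamma> \<le> 1\<close>, the
  step size can be removed, and the effective dimension depends on the spectrum and \<open>T\<close>
  only.\<close>

lemma gamma_lam_geo: "(\<gamma> * lam j * geo j n)\<^sup>2 \<le> eff_dim_term j" if "n \<le> T"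
  unfolding eff_dim_term_def
proof (rule power_mono)
  have "\<gamma> * lam j * geo j n \<le> 1 * lam j * real T"
    using geo_bounds[of j n] gamma_pos gamma_le_1 lam_nonneg[of j] that
    by (intro mult_mono) auto
  then show "\<gamma> * lam j * geo j n \<le> min 1 (lam j * real T)"
    using geo_bounds by simp
  show "0 \<le> \<gamma> * lam j * geo j n"
    using geo_bounds gamma_pos lam_nonneg by simp
qed

lemma eff_dim_summable: "summable eff_dim_term"
proof (rule summable_comparison_test')
  show "summable (\<lambda>j. lam j * real T)"
    using summable_lam by (rule summable_mult2)
  show "norm (eff_dim_term j) \<le> lam j * real T" if "0 \<le> j" for j
  proof -
    have "(min 1 x)\<^sup>2 \<le> x" if "0 \<le> x" for x :: real
      using that by (auto simp: min_def power2_eq_square intro: mult_left_le_one_le)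
    then show ?thesis
      using lam_nonneg[of j] by (simp add: eff_dim_term_def)
  qed
qed

text \<open>The bound on a fluctuation without its factor \<open>lam j\<close>, so that the sums
  over coordinates and over data points separate.\<close>

definition noise_level :: "nat \<times> nat \<Rightarrow> ennreal" where
  "noise_level i = ennreal (3/2 * \<tau>) * hbar (fst i) (snd i) + ennreal (3 * s)"

text \<open>In the bias, one factor \<open>geo j T\<close> is paired with
  \<open>\<gamma> * lam j\<close> and bounded by 1, the other is bounded by \<open>T\<close>. In the
  noise, one \<open>lam j\<close> from the risk and one from \<open>fluct_second_moment\<close>
  combine with the weight to \<open>(\<gamma> * lam j * geo j n)\<^sup>2\<close>.\<close>

lemma avg_err_coordinate_second_moment:
  assumes pos: "0 < M" "0 < T"
  shows "(\<integral>\<^sup>+\<omega>. ennreal (lam j * (avg_err \<omega> \<bullet> e j)\<^sup>2) \<partial>P)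
    \<le> ennreal ((ws \<bullet> e j)\<^sup>2 / (\<gamma> * real T))
      + ennreal (eff_dim_term j / (real M * real T)\<^sup>2) * (\<Sum>i\<in>I. noise_level i)"
proof -
  let ?b = "- (ws \<bullet> e j) * geo j T / real T"
  let ?c = "\<lambda>i. \<gamma> / (real M * real T) * geo j (T - 1 - snd i)"
  let ?E = "\<lambda>i. \<integral>\<omega>. (fluct j i \<omega>)\<^sup>2 \<partial>P"
  have coord: "avg_err \<omega> \<bullet> e j = ?b + (\<Sum>i\<in>I. ?c i * fluct j i \<omega>)" for \<omega>
    by (rule avg_err_coordinate[OF pos(1)])
  have sm: "integrable P (\<lambda>\<omega>. (avg_err \<omega> \<bullet> e j)\<^sup>2)"
      "(\<integral>\<omega>. (avg_err \<omega> \<bullet> e j)\<^sup>2 \<partial>P) = ?b\<^sup>2 + (\<Sum>i\<in>I. (?c i)\<^sup>2 * ?E i)"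
    unfolding coord
    by (intro second_moment_orthogonal_sum measurable_fluct integrable_fluct_square fluct_mean
        fluct_orthogonal; simp)+
  have "(\<integral>\<^sup>+\<omega>. ennreal (lam j * (avg_err \<omega> \<bullet> e j)\<^sup>2) \<partial>P)
      = ennreal (\<integral>\<omega>. lam j * (avg_err \<omega> \<bullet> e j)\<^sup>2 \<partial>P)"
    using sm lam_nonneg by (intro nn_integral_eq_integral) auto
  also have "(\<integral>\<omega>. lam j * (avg_err \<omega> \<bullet> e j)\<^sup>2 \<partial>P)
      = lam j * ?b\<^sup>2 + (\<Sum>i\<in>I. lam j * (?c i)\<^sup>2 * ?E i)"
    by (simp add: sm distrib_left sum_distrib_left mult.assoc)
  also have "ennreal \<dots> = ennreal (lam j * ?b\<^sup>2) + (\<Sum>i\<in>I. ennreal (lam j * (?c i)\<^sup>2 * ?E i))"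
    using lam_nonneg by (subst ennreal_plus) (auto intro!: sum_nonneg)
  also have "\<dots> \<le> ennreal ((ws \<bullet> e j)\<^sup>2 / (\<gamma> * real T))
      + (\<Sum>i\<in>I. ennreal (eff_dim_term j / (real M * real T)\<^sup>2) * noise_level i)"
  proof (intro add_mono sum_mono ennreal_leI)
    have "lam j * ?b\<^sup>2 = (ws \<bullet> e j)\<^sup>2 / (\<gamma> * (real T)\<^sup>2) * ((\<gamma> * lam j * geo j T) * geo j T)"
      using gamma_pos by (simp add: power2_eq_square field_simps)
    also have "\<dots> \<le> (ws \<bullet> e j)\<^sup>2 / (\<gamma> * (real T)\<^sup>2) * (1 * real T)"
      using geo_bounds[of j T] gamma_pos by (intro mult_left_mono mult_mono) auto
    also have "\<dots> = (ws \<bullet> e j)\<^sup>2 / (\<gamma> * real T)"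
      using pos by (simp add: power2_eq_square)
    finally show "lam j * ?b\<^sup>2 \<le> (ws \<bullet> e j)\<^sup>2 / (\<gamma> * real T)" .
  next
    fix i assume i: "i \<in> I"
    have "ennreal (lam j * (?c i)\<^sup>2 * ?E i) = ennreal (lam j * (?c i)\<^sup>2) * (\<integral>\<^sup>+\<omega>. ennreal ((fluct j i \<omega>)\<^sup>2) \<partial>P)"
      using lam_nonneg integrable_fluct_square[OF i]
      by (simp add: ennreal_mult nn_integral_eq_integral)
    also have "\<dots> \<le> ennreal (lam j * (?c i)\<^sup>2) * (ennreal (lam j) * noise_level i)"
      unfolding noise_level_def by (intro mult_left_mono fluct_second_moment i) simp
    also have "\<dots> = ennreal (lam j * (?c i)\<^sup>2 * lam j) * noise_level i"
      using lam_nonneg by (simp add: ennreal_mult mult_ac)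
    also have "lam j * (?c i)\<^sup>2 * lam j = (\<gamma> * lam j * geo j (T - 1 - snd i))\<^sup>2 / (real M * real T)\<^sup>2"
      by (simp add: power2_eq_square)
    also have "ennreal \<dots> * noise_level i \<le> ennreal (eff_dim_term j / (real M * real T)\<^sup>2) * noise_level i"
      by (intro mult_right_mono ennreal_leI divide_right_mono gamma_lam_geo) auto
    finally show "ennreal (lam j * (?c i)\<^sup>2 * ?E i)
        \<le> ennreal (eff_dim_term j / (real M * real T)\<^sup>2) * noise_level i" .
  qed
  finally show ?thesis by (simp add: sum_distrib_left)
qed

text \<open>\<open>hbar_sum\<close> is inserted on each node. The noise coefficient 12 consists of 9
  from the feedback through \<tau>, reduced by \<open>gamma_tau\<close>, and 3 from the label noise
  itself.\<close>

lemma noise_level_sum: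
  "(\<Sum>i\<in>I. noise_level i) \<le> ennreal (real M * (3 * \<tau> * (norm ws)\<^sup>2 / \<gamma> + 12 * s * real T))"
proof -
  let ?B = "2/\<gamma> * ((norm ws)\<^sup>2 + real T * (3 * \<gamma>\<^sup>2 * s * suminf lam))"
  have B: "0 \<le> ?B"
    using gamma_pos s_nonneg suminf_lam_nonneg by simp
  have "(\<Sum>i\<in>I. noise_level i) = (\<Sum>m<M. \<Sum>t<T. noise_level (m, t))"
    by (simp add: sum.cartesian_product)
  also have "\<dots> = (\<Sum>m<M. ennreal (3/2 * \<tau>) * (\<Sum>t<T. hbar m t) + of_nat T * ennreal (3 * s))"
    by (simp add: noise_level_def sum.distrib sum_distrib_left)
  also have "\<dots> \<le> (\<Sum>m<M. ennreal (3/2 * \<tau>) * ennreal ?B + of_nat T * ennreal (3 * s))"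
    by (intro sum_mono add_right_mono mult_left_mono hbar_sum) auto
  also have "\<dots> = ennreal (real M) * (ennreal (3/2 * \<tau>) * ennreal ?B + ennreal (real T) * ennreal (3 * s))"
    by (simp add: ennreal_of_nat_eq_real_of_nat)
  also have "\<dots> = ennreal (real M * (3/2 * \<tau> * ?B + real T * (3 * s)))"
    using B tau_nonneg s_nonneg
    by (simp only: ennreal_mult[symmetric] ennreal_plus[symmetric] mult_nonneg_nonneg add_nonneg_nonneg
        of_nat_0_le_iff zero_le_numeral zero_le_divide_iff divide_nonneg_nonneg)
  also have "\<dots> \<le> ennreal (real M * (3 * \<tau> * (norm ws)\<^sup>2 / \<gamma> + 12 * s * real T))"
  proof (intro ennreal_leI mult_left_mono)
    have "3/2 * \<tau> * ?B + real T * (3 * s)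
        = 3 * \<tau> * (norm ws)\<^sup>2 / \<gamma> + 9 * (s * real T) * (\<gamma> * \<tau> * suminf lam) + 3 * (s * real T)"
      using gamma_pos by (simp add: field_simps power2_eq_square)
    also have "\<dots> \<le> 3 * \<tau> * (norm ws)\<^sup>2 / \<gamma> + 9 * (s * real T) * 1 + 3 * (s * real T)"
      using gamma_tau s_nonneg by (intro add_mono mult_left_mono) auto
    finally show "3/2 * \<tau> * ?B + real T * (3 * s) \<le> 3 * \<tau> * (norm ws)\<^sup>2 / \<gamma> + 12 * s * real T"
      by simp
  qed simp
  finally show ?thesis .
qed

lemma measurable_avg_err: "avg_err \<in> borel_measurable P"
  unfolding avg_err_def[abs_def]
  by (intro borel_measurable_scaleR borel_measurable_sum measurable_err_path) auto

text \<open>Bessel's inequality sums the bias over the coordinates. The total noise level is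
  proportional to \<open>M\<close> with terms up to order \<open>T\<close>, which cancels one factor
  \<open>M * T\<close> of the squared denominator.\<close>

lemma excess_bound:
  assumes pos: "0 < M" "0 < T"
  shows "(\<integral>\<^sup>+\<omega>. ennreal (h (avg_err \<omega>)) \<partial>P)
    \<le> ennreal ((norm ws)\<^sup>2 / (\<gamma> * real T)
        + suminf eff_dim_term / (real M * real T) * (3 * \<tau> * (norm ws)\<^sup>2 / (\<gamma> * real T) + 12 * s))"
proof -
  note [measurable] = measurable_avg_err
  let ?q = "\<lambda>j. (ws \<bullet> e j)\<^sup>2 / (\<gamma> * real T)" and ?d = "\<lambda>j. eff_dim_term j / (real M * real T)\<^sup>2"
  let ?N = "\<Sum>i\<in>I. noise_level i"
  let ?K = "real M * (3 * \<tau> * (norm ws)\<^sup>2 / \<gamma> + 12 * s * real T)"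
  have d: "summable ?d" "\<And>j. 0 \<le> ?d j"
    using eff_dim_summable by (auto simp: eff_dim_term_def[abs_def])
  have q: "summable ?q"
    using energy_eq(1) by (rule summable_divide)
  have K: "0 \<le> ?K" using tau_nonneg gamma_pos s_nonneg by simp
  have "(\<integral>\<^sup>+\<omega>. ennreal (h (avg_err \<omega>)) \<partial>P) = (\<Sum>j. \<integral>\<^sup>+\<omega>. ennreal (lam j * (avg_err \<omega> \<bullet> e j)\<^sup>2) \<partial>P)"
    unfolding ennreal_h by (rule nn_integral_suminf) simp
  also have "\<dots> \<le> (\<Sum>j. ennreal (?q j) + ennreal (?d j) * ?N)"
    by (intro suminf_le summableI avg_err_coordinate_second_moment pos)
  also have "\<dots> = (\<Sum>j. ennreal (?q j)) + (\<Sum>j. ennreal (?d j)) * ?N"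
    by (simp add: suminf_add[symmetric] ennreal_suminf_multc)
  also have "\<dots> = ennreal (suminf ?q) + ennreal (suminf ?d) * ?N"
    using q d gamma_pos by (simp add: suminf_ennreal2)
  also have "\<dots> \<le> ennreal ((norm ws)\<^sup>2 / (\<gamma> * real T)) + ennreal (suminf ?d) * ennreal ?K"
  proof (intro add_mono mult_left_mono noise_level_sum ennreal_leI)
    have "suminf ?q = (\<Sum>j. (ws \<bullet> e j)\<^sup>2) / (\<gamma> * real T)"
      using energy_eq(1) by (rule suminf_divide)
    then show "suminf ?q \<le> (norm ws)\<^sup>2 / (\<gamma> * real T)"
      using energy_eq(3)[of ws] gamma_pos by (simp add: divide_right_mono)
  qed simp
  also have "\<dots> = ennreal ((norm ws)\<^sup>2 / (\<gamma> * real T) + suminf ?d * ?K)"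
    using K gamma_pos suminf_nonneg[OF d]
    by (simp add: ennreal_mult[symmetric] ennreal_plus[symmetric] del: ennreal_plus)
  also have "suminf ?d = suminf eff_dim_term / (real M * real T)\<^sup>2"
    using eff_dim_summable by (rule suminf_divide)
  also have "suminf eff_dim_term / (real M * real T)\<^sup>2 * ?K
      = suminf eff_dim_term / (real M * real T) * (3 * \<tau> * (norm ws)\<^sup>2 / (\<gamma> * real T) + 12 * s)"
    using pos gamma_pos by (simp add: field_simps power2_eq_square)
  finally show ?thesis .
qed

end

section \<open>Rates for power law spectra\<close>

text \<open>With \<open>u = T powr (1 / (1 + r))\<close>, the terms before \<open>K\<close>, which
  is \<open>u\<close> rounded up, are bounded by 1; beyond them the base
  \<open>(u / (j + 1)) powr (1 + r)\<close> is at most \<open>u / (j + 1)\<close>. As the terms are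
  squared this linear bound is summable, with a constant free of \<open>r\<close>.\<close>

lemma power_law_effective_dimension:
  fixes r T :: real
  assumes r: "0 < r" and T: "1 \<le> T"
    and summ: "summable (\<lambda>j. (min 1 (real (Suc j) powr - (1 + r) * T))\<^sup>2)"
  shows "(\<Sum>j. (min 1 (real (Suc j) powr - (1 + r) * T))\<^sup>2) \<le> 3 * T powr (1 / (1 + r))"
proof -
  let ?t = "\<lambda>j. (min 1 (real (Suc j) powr - (1 + r) * T))\<^sup>2"
  define u where "u = T powr (1 / (1 + r))"
  define K where "K = nat \<lceil>u\<rceil>"
  have u1: "1 \<le> u" using T r by (simp add: u_def ge_one_powr_ge_zero)
  then have K: "u \<le> real K" "real K \<le> u + 1" "0 < K"
    unfolding K_def by linarith+
  have Tu: "T = u powr (1 + r)" using T r by (simp add: u_def powr_powr)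
  have t1: "?t j \<le> 1" for j
    using T by (intro power_le_one) auto
  have t2: "?t j \<le> u\<^sup>2 * (1 / real j - 1 / real (Suc j))" if j: "K \<le> j" for j
  proof -
    have uj: "0 \<le> u / real (Suc j)" "u / real (Suc j) \<le> 1" using K j u1 by auto
    have "real (Suc j) powr - (1 + r) * T = (u / real (Suc j)) powr (1 + r)"
      unfolding Tu powr_minus_divide using u1 by (simp add: powr_divide)
    also have "\<dots> \<le> (u / real (Suc j)) powr 1"
      using uj r by (intro powr_mono') auto
    finally have "real (Suc j) powr - (1 + r) * T \<le> u / real (Suc j)"
      using u1 by simp
    then have "?t j \<le> (u / real (Suc j))\<^sup>2"
      using T by (intro power_mono) auto
    also have "\<dots> = u\<^sup>2 * (1 / (real (Suc j) * real (Suc j)))"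
      by (simp add: power2_eq_square)
    also have "\<dots> \<le> u\<^sup>2 * (1 / (real j * real (Suc j)))"
      using j K by (intro mult_left_mono divide_left_mono mult_right_mono) auto
    also have "1 / (real j * real (Suc j)) = 1 / real j - 1 / real (Suc j)"
      using j K by (simp add: field_simps)
    finally show ?thesis .
  qed
  \<comment> \<open>The telescoping tail starts at \<open>K\<close>; up to there every term counts
    as 1.\<close>
  have partial: "(\<Sum>j<n. ?t j) \<le> (if n \<le> K then real n else real K + u\<^sup>2 * (1 / real K - 1 / real n))" for n
  proof (induction n)
    case (Suc n)
    show ?case
    proof (cases "n < K")
      case True
      then show ?thesis using Suc t1[of n] by simp
    next
      case False
      then have "(\<Sum>j<n. ?t j) \<le> real K + u\<^sup>2 * (1 / real K - 1 / real n)"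
        using Suc by (cases "n = K") auto
      then have "(\<Sum>j<Suc n. ?t j) \<le> real K + u\<^sup>2 * (1 / real K - 1 / real n)
          + u\<^sup>2 * (1 / real n - 1 / real (Suc n))"
        using t2[of n] False by simp
      then show ?thesis using False by (simp add: algebra_simps)
    qed
  qed simp
  have "(\<Sum>j<n. ?t j) \<le> 3 * u" for n
  proof -
    have "u\<^sup>2 * (1 / real K - 1 / real n) \<le> u\<^sup>2 * (1 / real K)"
      by (intro mult_left_mono) auto
    also have "\<dots> \<le> u\<^sup>2 * (1 / u)"
      using K u1 by (intro mult_left_mono divide_left_mono) auto
    also have "\<dots> = u" using u1 by (simp add: power2_eq_square)
    \<comment> \<open>Here \<open>K \<le> u + 1 \<le> 2 * u\<close>, and the tail adds at most
      \<open>u\<close>.\<close>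
    finally show ?thesis using partial[of n] K u1 by (auto split: if_splits)
  qed
  then show ?thesis
    unfolding u_def[symmetric] by (intro suminf_le_const summ)
qed

text \<open>The sample size \<open>M * T\<close> contains \<open>M\<close>; raising to the power
  \<open>(2 + r) / (1 + r)\<close> and cancelling a power of \<open>M\<close> solves the hypothesis
  for \<open>M\<close>. The first bound compares bias and variance, the second shows that
  \<open>T\<close> grows at least like the square root of the sample size.\<close>

lemma node_count_bounds:
  fixes r R \<gamma> :: real and M T :: nat
  assumes r: "0 < r" and R: "0 < R" and \<gamma>: "0 < \<gamma>" "\<gamma> < 1" and pos: "0 < M" "0 < T"
    and M: "real M \<le> (\<gamma> / R\<^sup>2) powr ((1 + r) / (2 + r)) * (\<gamma> * real (M * T)) powr (1 / (2 + r))"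
  shows "real M * (R\<^sup>2 / \<gamma>) \<le> real T powr (1 / (1 + r))"
    and "real (M * T) \<le> \<gamma> / R\<^sup>2 * (real T)\<^sup>2"
proof -
  let ?a = "1 / (1 + r)"
  have "real M powr ((2 + r) / (1 + r))
      \<le> ((\<gamma> / R\<^sup>2) powr ((1 + r) / (2 + r)) * (\<gamma> * real (M * T)) powr (1 / (2 + r))) powr ((2 + r) / (1 + r))"
    using M r by (intro powr_mono2) auto
  also have "\<dots> = \<gamma> / R\<^sup>2 * (\<gamma> * real (M * T)) powr ?a"
    using r R \<gamma> by (simp add: powr_mult powr_powr)
  also have "(\<gamma> * real (M * T)) powr ?a = real M powr ?a * (\<gamma> * real T) powr ?a"
    using \<gamma> by (simp add: powr_mult[symmetric] mult_ac)
  also have "(2 + r) / (1 + r) = 1 + ?a"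
    using r by (simp add: field_simps)
  finally have "real M * real M powr ?a \<le> \<gamma> / R\<^sup>2 * (\<gamma> * real T) powr ?a * real M powr ?a"
    using pos by (simp add: powr_add mult_ac)
  then have "real M \<le> \<gamma> / R\<^sup>2 * (\<gamma> * real T) powr ?a"
    using pos by (simp only: mult_le_cancel_right_pos powr_gt_zero of_nat_0_less_iff)
  also have "\<dots> \<le> \<gamma> / R\<^sup>2 * real T powr ?a"
    using \<gamma> r by (intro mult_left_mono powr_mono2 mult_left_le_one_le) auto
  finally have MT: "real M \<le> \<gamma> / R\<^sup>2 * real T powr ?a" .
  then show "real M * (R\<^sup>2 / \<gamma>) \<le> real T powr ?a"
    using R \<gamma> by (simp add: field_simps)
  have "real T powr ?a \<le> real T powr 1"
    using pos r by (intro powr_mono) auto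
  then have "\<gamma> / R\<^sup>2 * real T powr ?a \<le> \<gamma> / R\<^sup>2 * real T"
    using \<gamma> pos by (intro mult_left_mono) auto
  with MT have "real M \<le> \<gamma> / R\<^sup>2 * real T" by linarith
  then have "real M * real T \<le> \<gamma> / R\<^sup>2 * real T * real T"
    by (intro mult_right_mono) auto
  then show "real (M * T) \<le> \<gamma> / R\<^sup>2 * (real T)\<^sup>2"
    by (simp add: power2_eq_square)
qed

text \<open>In units of \<open>T powr (1 / (1 + r)) / (M * T)\<close>, the bias contributes 1 and
  the variance \<open>3 * (1 + 12 * \<sigma>\<^sup>2)\<close>. The lower bound on \<open>T\<close>
  bounds the term with \<tau> by 1 and keeps \<open>R\<close> out of the constant. The outer factor
  2 meets the 1/2 in the risk.\<close>

lemma rate_bound: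
  fixes r R \<gamma> \<tau> \<sigma> b D :: real and M T :: nat
  assumes r: "0 < r" and R: "0 < R" and \<gamma>: "0 < \<gamma>" and \<tau>: "0 \<le> \<tau>" and pos: "0 < M" "0 < T"
    and b: "0 \<le> b" "b \<le> R"
    and M: "real M * (R\<^sup>2 / \<gamma>) \<le> real T powr (1 / (1 + r))"
    and T: "3 * \<tau> * R\<^sup>2 / \<gamma> \<le> real T"
    and D: "D \<le> 3 * real T powr (1 / (1 + r))"
  shows "b\<^sup>2 / (\<gamma> * real T) + D / (real M * real T) * (3 * \<tau> * b\<^sup>2 / (\<gamma> * real T) + 12 * \<sigma>\<^sup>2)
    \<le> 2 * ((2 + 18 * \<sigma>\<^sup>2) / \<gamma> * (\<gamma> / real M) * (real M / real (M * T)) powr (r / (1 + r)))"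
proof -
  let ?u = "real T powr (1 / (1 + r))" and ?\<rho> = "(real M / real (M * T)) powr (r / (1 + r))"
  have "1 / real T = real T powr - 1"
    using pos by (simp add: powr_minus_divide)
  then have \<rho>: "?\<rho> = ?u / real T"
  proof -
    have "?\<rho> = (1 / real T) powr (r / (1 + r))" using pos by simp
    also have "\<dots> = real T powr - (r / (1 + r))" using pos by (simp add: powr_divide powr_minus_divide)
    also have "- (r / (1 + r)) = 1 / (1 + r) - 1" using r by (simp add: field_simps)
    also have "real T powr (1 / (1 + r) - 1) = ?u / real T" using pos by (simp add: powr_diff)
    finally show ?thesis .
  qed
  have b2: "b\<^sup>2 \<le> R\<^sup>2" using b by (intro power_mono) auto
  have "b\<^sup>2 / (\<gamma> * real T) \<le> R\<^sup>2 / (\<gamma> * real T)"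
    using b2 \<gamma> by (intro divide_right_mono) auto
  also have "\<dots> = real M * (R\<^sup>2 / \<gamma>) / (real M * real T)"
    using pos by simp
  also have "\<dots> \<le> ?u / (real M * real T)"
    using M by (intro divide_right_mono) auto
  finally have 1: "b\<^sup>2 / (\<gamma> * real T) \<le> ?u / (real M * real T)" .
  have "3 * \<tau> * b\<^sup>2 / (\<gamma> * real T) \<le> 3 * \<tau> * R\<^sup>2 / (\<gamma> * real T)"
    using b2 \<gamma> \<tau> by (intro divide_right_mono mult_left_mono) auto
  also have "\<dots> \<le> 1"
    using T pos \<gamma> by (simp add: field_simps)
  finally have 2: "3 * \<tau> * b\<^sup>2 / (\<gamma> * real T) \<le> 1" .
  have "D / (real M * real T) * (3 * \<tau> * b\<^sup>2 / (\<gamma> * real T) + 12 * \<sigma>\<^sup>2)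
      \<le> 3 * ?u / (real M * real T) * (1 + 12 * \<sigma>\<^sup>2)"
    using 2 D \<tau> \<gamma> by (intro mult_mono divide_right_mono add_mono) auto
  with 1 have "b\<^sup>2 / (\<gamma> * real T) + D / (real M * real T) * (3 * \<tau> * b\<^sup>2 / (\<gamma> * real T) + 12 * \<sigma>\<^sup>2)
      \<le> ?u / (real M * real T) + 3 * ?u / (real M * real T) * (1 + 12 * \<sigma>\<^sup>2)"
    by (rule add_mono)
  also have "\<dots> = 2 * ((2 + 18 * \<sigma>\<^sup>2) / \<gamma> * (\<gamma> / real M) * (?u / real T))"
    using \<gamma> pos by (simp add: field_simps)
  finally show ?thesis unfolding \<rho> .
qed

section \<open>Covariance, noise and risk\<close>

lemma moment_operator_inner:
  assumes "moment_operator_exists P f X"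
  shows "integrable P (\<lambda>\<omega>. f \<omega> * (w \<bullet> X \<omega>) * (v \<bullet> X \<omega>))"
    and "moment_operator P f X w \<bullet> v = (\<integral>\<omega>. f \<omega> * (w \<bullet> X \<omega>) * (v \<bullet> X \<omega>) \<partial>P)"
proof -
  have i: "integrable P (\<lambda>\<omega>. (f \<omega> * (w \<bullet> X \<omega>)) *\<^sub>R X \<omega>)"
    using assms by (simp add: moment_operator_exists_def)
  show "integrable P (\<lambda>\<omega>. f \<omega> * (w \<bullet> X \<omega>) * (v \<bullet> X \<omega>))"
    using integrable_inner_left[of v, OF i] by (simp add: inner_commute[of v])
  show "moment_operator P f X w \<bullet> v = (\<integral>\<omega>. f \<omega> * (w \<bullet> X \<omega>) * (v \<bullet> X \<omega>) \<partial>P)"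
    unfolding moment_operator_def using i by (subst integral_inner_left[symmetric]) (simp_all add: inner_commute[of v])
qed

lemma moment_operator_scale: "moment_operator P f X (c *\<^sub>R v) = c *\<^sub>R moment_operator P f X v"
  unfolding moment_operator_def by (simp flip: integral_scaleR_right add: mult_ac)

text \<open>The remainder of the expansion of \<open>v\<close> lies in the kernel, and by symmetry
  it contributes nothing to the quadratic form. The expansion can then be paired term by term with
  the covariance of \<open>v\<close>.\<close>

lemma covariance_eigen_expansion:
  assumes ex: "covariance_exists P X"
    and e: "\<And>i j. e i \<bullet> e j = (if i = j then 1 else (0::real))"
    and eig: "\<And>j. covariance P X (e j) = lam j *\<^sub>R e j"
    and ker: "\<And>u. (\<forall>j. e j \<bullet> u = 0) \<Longrightarrow> covariance P X u = 0"
  shows "(\<lambda>j. lam j * (v \<bullet> e j)\<^sup>2) sums (covariance P X v \<bullet> v)"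
proof -
  have sym: "covariance P X a \<bullet> b = covariance P X b \<bullet> a" for a b
    using moment_operator_inner(2)[OF ex] by (simp add: mult.commute)
  obtain p where p: "((\<lambda>i. (v \<bullet> e i) *\<^sub>R e i) has_sum p) UNIV" "\<And>i. (v - p) \<bullet> e i = 0"
    using fourier_expansion[of UNIV e v] e by auto
  have "covariance P X (v - p) = 0"
    using p(2) by (intro ker) (simp add: inner_commute)
  then have "covariance P X v \<bullet> (v - p) = 0"
    by (subst sym) simp
  then have vp: "covariance P X v \<bullet> p = covariance P X v \<bullet> v"
    by (simp add: inner_diff_right)
  have "((\<lambda>i. covariance P X v \<bullet> ((v \<bullet> e i) *\<^sub>R e i)) has_sum (covariance P X v \<bullet> p)) UNIV"
    by (rule has_sum_bounded_linear[OF bounded_linear_inner_right p(1)])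
  then have "(\<lambda>i. covariance P X v \<bullet> ((v \<bullet> e i) *\<^sub>R e i)) sums (covariance P X v \<bullet> v)"
    unfolding vp by (rule has_sum_imp_sums)
  moreover have "covariance P X v \<bullet> ((v \<bullet> e j) *\<^sub>R e j) = lam j * (v \<bullet> e j)\<^sup>2" for j
    using sym[of v "e j"] by (simp add: eig power2_eq_square inner_commute[of "e j"])
  ultimately show ?thesis by simp
qed

text \<open>The condition is applied to the rank one operator of \<open>v\<close>, whose trace
  against the covariance is \<open>covariance P X v \<bullet> v\<close>.\<close>

lemma rank_one_fourth_moment:
  assumes ex: "covariance_exists P X" and fm: "fourth_moment_bound P X \<tau>"
  shows "integrable P (\<lambda>\<omega>. ((v \<bullet> X \<omega>) * (w \<bullet> X \<omega>))\<^sup>2)"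
    and "(\<integral>\<omega>. ((v \<bullet> X \<omega>) * (w \<bullet> X \<omega>))\<^sup>2 \<partial>P)
      \<le> \<tau> * (covariance P X v \<bullet> v) * (covariance P X w \<bullet> w)"
proof -
  let ?A = "\<lambda>u. (v \<bullet> u) *\<^sub>R v"
  have "bounded_linear ?A"
    by (intro bounded_linear_scaleR_const bounded_linear_inner_right)
  then have "psd_operator ?A"
    by (simp add: psd_operator_def inner_commute[of v])
  then have m: "moment_operator_exists P (\<lambda>\<omega>. X \<omega> \<bullet> ?A (X \<omega>)) X"
    and le: "loewner_le (moment_operator P (\<lambda>\<omega>. X \<omega> \<bullet> ?A (X \<omega>)) X)
         (\<lambda>w. (\<tau> * operator_trace (covariance P X \<circ> ?A)) *\<^sub>R covariance P X w)"
    using fm unfolding fourth_moment_bound_def by blast+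
  have eq: "X \<omega> \<bullet> ?A (X \<omega>) * (w \<bullet> X \<omega>) * (w \<bullet> X \<omega>) = ((v \<bullet> X \<omega>) * (w \<bullet> X \<omega>))\<^sup>2" for \<omega>
    by (simp add: power2_eq_square inner_commute mult_ac)
  show "integrable P (\<lambda>\<omega>. ((v \<bullet> X \<omega>) * (w \<bullet> X \<omega>))\<^sup>2)"
    using moment_operator_inner(1)[OF m, of w w] unfolding eq .
  have "operator_trace (covariance P X \<circ> ?A) = covariance P X v \<bullet> v"
    by (rule operator_trace_rank_one) (rule moment_operator_scale)
  moreover have "moment_operator P (\<lambda>\<omega>. X \<omega> \<bullet> ?A (X \<omega>)) X w \<bullet> w
      \<le> \<tau> * operator_trace (covariance P X \<circ> ?A) * (covariance P X w \<bullet> w)"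
    using le unfolding loewner_le_def inner_scaleR_left by blast
  ultimately show "(\<integral>\<omega>. ((v \<bullet> X \<omega>) * (w \<bullet> X \<omega>))\<^sup>2 \<partial>P)
      \<le> \<tau> * (covariance P X v \<bullet> v) * (covariance P X w \<bullet> w)"
    unfolding moment_operator_inner(2)[OF m, of w w] eq by simp
qed

text \<open>The norm is an infimum, so the bound at \<open>w\<close> comes from the quotient
  \<open>?q\<close>, which lies below every admissible constant.\<close>

lemma whitened_noise_bound:
  assumes norm: "whitened_noise_norm P X Y ws = ennreal S" and S: "0 \<le> S"
    and pos: "0 < covariance P X w \<bullet> w"
  shows "integrable P (\<lambda>\<omega>. ((Y \<omega> - ws \<bullet> X \<omega>) * (w \<bullet> X \<omega>))\<^sup>2)"
    and "(\<integral>\<omega>. ((Y \<omega> - ws \<bullet> X \<omega>) * (w \<bullet> X \<omega>))\<^sup>2 \<partial>P) \<le> S * (covariance P X w \<bullet> w)"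
proof -
  let ?f = "\<lambda>\<omega>. (ws \<bullet> X \<omega> - Y \<omega>)\<^sup>2"
  let ?A = "{ennreal s | s. 0 \<le> s \<and> moment_operator_exists P ?f X \<and>
      loewner_le (moment_operator P ?f X) (\<lambda>w. s *\<^sub>R covariance P X w)}"
  have Inf: "Inf ?A = ennreal S" using norm by (simp add: whitened_noise_norm_def)
  \<comment> \<open>In \<open>ennreal\<close> the infimum of the empty set is infinite, so a finite
    norm yields an admissible constant and with it the existence of the operator.\<close>
  have "?A \<noteq> {}"
    using Inf by (metis Inf_empty ennreal_neq_top infinity_ennreal_def top_ennreal_def)
  then have m: "moment_operator_exists P ?f X" by blast
  have eq: "?f \<omega> * (w \<bullet> X \<omega>) * (w \<bullet> X \<omega>) = ((Y \<omega> - ws \<bullet> X \<omega>) * (w \<bullet> X \<omega>))\<^sup>2" for \<omega>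
    by (simp add: power2_eq_square algebra_simps)
  show "integrable P (\<lambda>\<omega>. ((Y \<omega> - ws \<bullet> X \<omega>) * (w \<bullet> X \<omega>))\<^sup>2)"
    using moment_operator_inner(1)[OF m, of w w] unfolding eq .
  have val: "moment_operator P ?f X w \<bullet> w = (\<integral>\<omega>. ((Y \<omega> - ws \<bullet> X \<omega>) * (w \<bullet> X \<omega>))\<^sup>2 \<partial>P)"
    using moment_operator_inner(2)[OF m, of w w] unfolding eq .
  let ?q = "(moment_operator P ?f X w \<bullet> w) / (covariance P X w \<bullet> w)"
  have "ennreal ?q \<le> Inf ?A"
  proof (rule Inf_greatest)
    fix a assume "a \<in> ?A"
    then obtain s where s: "a = ennreal s" "loewner_le (moment_operator P ?f X) (\<lambda>w. s *\<^sub>R covariance P X w)"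
      by blast
    then have "?q \<le> s"
      using pos by (simp add: loewner_le_def pos_divide_le_eq)
    then show "ennreal ?q \<le> a" unfolding s by (rule ennreal_leI)
  qed
  then have "?q \<le> S" unfolding Inf using S by simp
  then show "(\<integral>\<omega>. ((Y \<omega> - ws \<bullet> X \<omega>) * (w \<bullet> X \<omega>))\<^sup>2 \<partial>P) \<le> S * (covariance P X w \<bullet> w)"
    using pos unfolding val by (simp add: pos_divide_le_eq)
qed

lemma linear_term_zero:
  fixes c d :: real
  assumes "\<And>t. 2 * t * c \<le> t\<^sup>2 * d" and d: "0 \<le> d"
  shows "c = 0"
proof -
  \<comment> \<open>The test value for \<open>t\<close>; the summand 1 avoids division by
    zero.\<close>
  define x where "x = c / (d + 1)"
  have c: "c = x * (d + 1)" using d by (simp add: x_def)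
  have "x\<^sup>2 * (d + 2) \<le> 0"
    using assms(1)[of x] unfolding c by (simp add: power2_eq_square algebra_simps)
  then show ?thesis
    unfolding c using d by (simp add: mult_le_0_iff)
qed

text \<open>Finite minimal risk makes the residual square integrable. On each line through
  \<open>ws\<close> the risk is then a quadratic polynomial, whose linear term vanishes at the
  minimum; only the quadratic part remains as excess.\<close>

lemma (in prob_space) risk_minimizer:
  fixes X :: "'a \<Rightarrow> 'h::{real_inner, second_countable_topology}"
  assumes [measurable]: "X \<in> borel_measurable M" "Y \<in> borel_measurable M"
    and sq: "\<And>v. integrable M (\<lambda>\<omega>. (v \<bullet> X \<omega>)\<^sup>2)"
    and min: "\<And>v. risk M X Y ws \<le> risk M X Y v" and fin: "risk M X Y ws \<noteq> \<infinity>"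
  shows "integrable M (\<lambda>\<omega>. (Y \<omega> - ws \<bullet> X \<omega>) * (v \<bullet> X \<omega>))"
    and "(\<integral>\<omega>. (Y \<omega> - ws \<bullet> X \<omega>) * (v \<bullet> X \<omega>) \<partial>M) = 0"
    and "risk M X Y v = risk M X Y ws + ennreal ((\<integral>\<omega>. ((v - ws) \<bullet> X \<omega>)\<^sup>2 \<partial>M) / 2)"
proof -
  let ?\<xi> = "\<lambda>\<omega>. Y \<omega> - ws \<bullet> X \<omega>"
  have nn: "(\<integral>\<^sup>+\<omega>. ennreal ((?\<xi> \<omega>)\<^sup>2) \<partial>M) < \<infinity>"
    using fin by (auto simp: risk_def less_top[symmetric] ennreal_divide_eq_top_iff)
  have \<xi>: "integrable M (\<lambda>\<omega>. (?\<xi> \<omega>)\<^sup>2)"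
  proof (rule integrableI_bounded)
    show "(\<lambda>\<omega>. (?\<xi> \<omega>)\<^sup>2) \<in> borel_measurable M" by measurable
  qed (use nn in simp)
  have cross: "integrable M (\<lambda>\<omega>. ?\<xi> \<omega> * (v \<bullet> X \<omega>))" for v
    by (intro integrable_mult_of_squares \<xi> sq) measurable
  then show "integrable M (\<lambda>\<omega>. ?\<xi> \<omega> * (v \<bullet> X \<omega>))" .
  have expand: "(Y \<omega> - w \<bullet> X \<omega>)\<^sup>2
      = (?\<xi> \<omega>)\<^sup>2 - 2 * (?\<xi> \<omega> * ((w - ws) \<bullet> X \<omega>)) + ((w - ws) \<bullet> X \<omega>)\<^sup>2" for w \<omega>
    by (simp add: inner_diff_left power2_eq_square algebra_simps)
  have int: "integrable M (\<lambda>\<omega>. (Y \<omega> - w \<bullet> X \<omega>)\<^sup>2)" for w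
    unfolding expand[of _ w] using \<xi> cross sq by simp
  have risk: "risk M X Y w = ennreal ((\<integral>\<omega>. (Y \<omega> - w \<bullet> X \<omega>)\<^sup>2 \<partial>M) / 2)" for w
    unfolding risk_def using int divide_ennreal[of "\<integral>\<omega>. (Y \<omega> - w \<bullet> X \<omega>)\<^sup>2 \<partial>M" 2]
    by (simp add: nn_integral_eq_integral)
  have val: "(\<integral>\<omega>. (Y \<omega> - w \<bullet> X \<omega>)\<^sup>2 \<partial>M) = (\<integral>\<omega>. (?\<xi> \<omega>)\<^sup>2 \<partial>M)
      - 2 * (\<integral>\<omega>. ?\<xi> \<omega> * ((w - ws) \<bullet> X \<omega>) \<partial>M) + (\<integral>\<omega>. ((w - ws) \<bullet> X \<omega>)\<^sup>2 \<partial>M)" for w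
    unfolding expand[of _ w] using \<xi> cross sq by simp
  have orth: "(\<integral>\<omega>. ?\<xi> \<omega> * (v \<bullet> X \<omega>) \<partial>M) = 0" for v
  proof (rule linear_term_zero)
    fix t :: real
    have "(\<integral>\<omega>. (?\<xi> \<omega>)\<^sup>2 \<partial>M) \<le> (\<integral>\<omega>. (Y \<omega> - (ws + t *\<^sub>R v) \<bullet> X \<omega>)\<^sup>2 \<partial>M)"
      using min[of "ws + t *\<^sub>R v"] unfolding risk
      by simp
    also have "\<dots> = (\<integral>\<omega>. (?\<xi> \<omega>)\<^sup>2 \<partial>M)
        - 2 * t * (\<integral>\<omega>. ?\<xi> \<omega> * (v \<bullet> X \<omega>) \<partial>M) + t\<^sup>2 * (\<integral>\<omega>. (v \<bullet> X \<omega>)\<^sup>2 \<partial>M)"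
      by (subst val) (simp add: power_mult_distrib mult.left_commute[of _ t])
    finally show "2 * t * (\<integral>\<omega>. ?\<xi> \<omega> * (v \<bullet> X \<omega>) \<partial>M) \<le> t\<^sup>2 * (\<integral>\<omega>. (v \<bullet> X \<omega>)\<^sup>2 \<partial>M)"
      by simp
  qed simp
  then show "(\<integral>\<omega>. ?\<xi> \<omega> * (v \<bullet> X \<omega>) \<partial>M) = 0" .
  show "risk M X Y v = risk M X Y ws + ennreal ((\<integral>\<omega>. ((v - ws) \<bullet> X \<omega>)\<^sup>2 \<partial>M) / 2)"
    unfolding risk val[of v] orth
    by (subst ennreal_plus[symmetric]) (auto simp: add_divide_distrib)
qed

section \<open>Assembly of the rate\<close>

context sgd_sample
begin

text \<open>\<open>a\<close> stands for the minimal risk, and the inner integral is \<open>h\<close>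
  of the averaged error. \<open>large\<close> and the second bound of
  \<open>node_count_bounds\<close> make \<open>T\<close> large enough for
  \<open>rate_bound\<close>.\<close>

lemma power_law_excess_bound:
  assumes r: "0 < r" and lam: "\<And>j. lam j = real (Suc j) powr - (1 + r)"
    and R: "norm ws \<le> R" "0 < R" and \<gamma>: "\<gamma> < 1" and pos: "0 < M" "0 < T" and s: "s = \<sigma>\<^sup>2"
    and M: "real M \<le> (\<gamma> / R\<^sup>2) powr ((1 + r) / (2 + r)) * (\<gamma> * real (M * T)) powr (1 / (2 + r))"
    and large: "\<gamma> / R\<^sup>2 * (3 * \<tau> * R\<^sup>2 / \<gamma>)\<^sup>2 \<le> real (M * T)"
  shows "(\<integral>\<^sup>+\<omega>. a + ennreal ((\<integral>\<omega>'. ((distributed_sgd \<gamma> 0 M (M * T) (\<lambda>m t. Z (m, t) \<omega>) - ws) \<bullet> X \<omega>')\<^sup>2 \<partial>P) / 2) \<partial>P)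
    \<le> a + ennreal ((2 + 18 * \<sigma>\<^sup>2) / \<gamma> * (\<gamma> / real M) * (real M / real (M * T)) powr (r / (1 + r)))"
proof -
  let ?B = "(2 + 18 * \<sigma>\<^sup>2) / \<gamma> * (\<gamma> / real M) * (real M / real (M * T)) powr (r / (1 + r))"
  note nc = node_count_bounds[OF r R(2) gamma_pos \<gamma> pos M]
  have "\<gamma> / R\<^sup>2 * (3 * \<tau> * R\<^sup>2 / \<gamma>)\<^sup>2 \<le> \<gamma> / R\<^sup>2 * (real T)\<^sup>2"
    using large nc(2) by linarith
  then have "(3 * \<tau> * R\<^sup>2 / \<gamma>)\<^sup>2 \<le> (real T)\<^sup>2"
    using gamma_pos R by (simp only: mult_le_cancel_left_pos divide_pos_pos zero_less_power)
  then have T: "3 * \<tau> * R\<^sup>2 / \<gamma> \<le> real T"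
    by (rule power2_le_imp_le) simp
  have D: "suminf eff_dim_term \<le> 3 * real T powr (1 / (1 + r))"
    using power_law_effective_dimension[OF r, of "real T"] eff_dim_summable pos
    unfolding eff_dim_term_def[abs_def] lam by simp
  have "(\<integral>\<^sup>+\<omega>. ennreal (h (avg_err \<omega>)) \<partial>P) \<le> ennreal (2 * ?B)"
    using excess_bound[OF pos] unfolding s
    by (rule order_trans)
      (rule ennreal_leI[OF rate_bound[OF r R(2) gamma_pos tau_nonneg pos norm_ge_zero R(1) nc(1) T D]])
  then have le: "ennreal (1/2) * (\<integral>\<^sup>+\<omega>. ennreal (h (avg_err \<omega>)) \<partial>P) \<le> ennreal (1/2) * ennreal (2 * ?B)"
    by (rule mult_left_mono) simp
  have eq: "ennreal ((\<integral>\<omega>'. ((distributed_sgd \<gamma> 0 M (M * T) (\<lambda>m t. Z (m, t) \<omega>) - ws) \<bullet> X \<omega>')\<^sup>2 \<partial>P) / 2)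
      = ennreal (1/2) * ennreal (h (avg_err \<omega>))" for \<omega>
    using distributed_sgd_minus_optimum[OF pos, of "M * T" \<omega>] ennreal_mult[of "1/2" "h (avg_err \<omega>)"]
      h_nonneg pos
    by (simp add: h_def)
  have "(\<integral>\<^sup>+\<omega>. a + ennreal (1/2) * ennreal (h (avg_err \<omega>)) \<partial>P)
      = a + ennreal (1/2) * (\<integral>\<^sup>+\<omega>. ennreal (h (avg_err \<omega>)) \<partial>P)"
    using measurable_avg_err by (simp add: nn_integral_add nn_integral_cmult emeasure_space_1)
  also have "\<dots> \<le> a + ennreal (1/2) * ennreal (2 * ?B)"
    using le by (rule add_left_mono)
  also have "ennreal (1/2) * ennreal (2 * ?B) = ennreal ?B"
    using gamma_pos by (subst ennreal_mult[symmetric]) auto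
  finally show ?thesis unfolding eq .
qed

end

theorem corollary3p10:
  "\<exists>c :: real \<Rightarrow> real \<Rightarrow> real \<Rightarrow> real.
     \<forall>(P :: 'w measure) (X :: 'w \<Rightarrow> 'h::{real_inner, banach, second_countable_topology})
       (Y :: 'w \<Rightarrow> real) (ws :: 'h) (r :: real) (R :: real) (\<tau> :: real) (\<gamma> :: real) (\<sigma> :: real)
       (M :: nat \<Rightarrow> nat).
       prob_space P \<longrightarrow> X \<in> borel_measurable P \<longrightarrow> Y \<in> borel_measurable P \<longrightarrow>
       min_norm_minimizer (risk P X Y) ws \<longrightarrow>
       r > 0 \<longrightarrow> R > 0 \<longrightarrow>
       covariance_exists P X \<longrightarrow>
       eigenvalue_sequence (covariance P X) (\<lambda>j. real (Suc j) powr - (1 + r)) \<longrightarrow>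
       (AE \<omega> in P. nn_cond_exp P (vimage_algebra (space P) X borel)
                      (\<lambda>\<omega>. ennreal ((Y \<omega>)\<^sup>2)) \<omega> < \<infinity>) \<longrightarrow>
       \<tau> > 0 \<longrightarrow> fourth_moment_bound P X \<tau> \<longrightarrow>
       \<sigma> \<ge> 0 \<longrightarrow> whitened_noise_norm P X Y ws = ennreal (\<sigma>\<^sup>2) \<longrightarrow>
       0 < \<gamma> \<longrightarrow> \<gamma> < min 1 (1 / (\<tau> * operator_trace (covariance P X))) \<longrightarrow>
       norm ws \<le> R \<longrightarrow>
       (\<forall>\<^sub>F n in sequentially. M n > 0 \<and> M n dvd n \<and>
          real (M n) \<le> (\<gamma> / R\<^sup>2) powr ((1 + r) / (2 + r)) * (\<gamma> * real n) powr (1 / (2 + r))) \<longrightarrow>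
       (\<forall>\<^sub>F n in sequentially. \<forall>Z. iid_split_sample P X Y (M n) n Z \<longrightarrow>
          (\<integral>\<^sup>+\<omega>. risk P X Y (distributed_sgd \<gamma> 0 (M n) n (\<lambda>m t. Z m t \<omega>)) \<partial>P)
            \<le> risk P X Y ws
               + ennreal (c \<tau> \<gamma> \<sigma> * (\<gamma> / real (M n)) * (real (M n) / real n) powr (r / (1 + r))))"
\<comment> \<open>Dividing by \<gamma> cancels the factor \<gamma> in the rate; the numerator is
  half of the total \<open>4 + 36 * \<sigma>\<^sup>2\<close> of bias and variance.\<close>
proof (intro exI[of _ "\<lambda>\<tau> \<gamma> \<sigma>. (2 + 18 * \<sigma>\<^sup>2) / \<gamma>"] allI impI)
  fix P :: "'w measure" and X :: "'w \<Rightarrow> 'h" and Y :: "'w \<Rightarrow> real" and ws :: 'h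
    and r R \<tau> \<gamma> \<sigma> :: real and M :: "nat \<Rightarrow> nat"
  assume P: "prob_space P" and X[measurable]: "X \<in> borel_measurable P" and Y[measurable]: "Y \<in> borel_measurable P"
    and min: "min_norm_minimizer (risk P X Y) ws" and r: "r > 0" and R: "R > 0"
    and ex: "covariance_exists P X"
    and eig: "eigenvalue_sequence (covariance P X) (\<lambda>j. real (Suc j) powr - (1 + r))"
    and \<tau>: "\<tau> > 0" and fm: "fourth_moment_bound P X \<tau>"
    and wn: "whitened_noise_norm P X Y ws = ennreal (\<sigma>\<^sup>2)"
    and \<gamma>: "0 < \<gamma>" "\<gamma> < min 1 (1 / (\<tau> * operator_trace (covariance P X)))"
    and ws: "norm ws \<le> R"
    and M: "\<forall>\<^sub>F n in sequentially. M n > 0 \<and> M n dvd n \<and>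
          real (M n) \<le> (\<gamma> / R\<^sup>2) powr ((1 + r) / (2 + r)) * (\<gamma> * real n) powr (1 / (2 + r))"
  interpret prob_space P by (rule P)
  let ?lam = "\<lambda>j. real (Suc j) powr - (1 + r)"
  obtain e :: "nat \<Rightarrow> 'h" where e: "\<And>i j. e i \<bullet> e j = (if i = j then 1 else 0)"
    and He: "\<And>j. covariance P X (e j) = ?lam j *\<^sub>R e j"
    and ker: "\<And>u. (\<forall>j. e j \<bullet> u = 0) \<Longrightarrow> covariance P X u = 0"
    using eig unfolding eigenvalue_sequence_def by blast
  have lam_pos: "0 < ?lam j" and lam_nonneg: "0 \<le> ?lam j" for j by simp_all
  have \<gamma>1: "\<gamma> \<le> 1" using \<gamma> by simp
  have lam_le: "?lam j \<le> 1" for j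
    using r powr_mono[of "- (1 + r)" 0 "real (Suc j)"] by simp
  have cov: "covariance P X v \<bullet> w = (\<integral>\<omega>. (v \<bullet> X \<omega>) * (w \<bullet> X \<omega>) \<partial>P)" for v w
    using moment_operator_inner(2)[OF ex] by simp
  have cov_sq: "covariance P X v \<bullet> v = (\<integral>\<omega>. (v \<bullet> X \<omega>)\<^sup>2 \<partial>P)" for v
    unfolding cov by (simp add: power2_eq_square)
  have sq: "integrable P (\<lambda>\<omega>. (v \<bullet> X \<omega>)\<^sup>2)" for v
    using moment_operator_inner(1)[OF ex, of v v] by (simp add: power2_eq_square)
  have sums: "(\<lambda>j. ?lam j * (v \<bullet> e j)\<^sup>2) sums (covariance P X v \<bullet> v)" for v
    by (rule covariance_eigen_expansion[OF ex e He ker])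
  have He_e: "covariance P X (e j) \<bullet> e j = ?lam j" for j
    by (simp add: He e)
  let ?tr = "operator_trace (covariance P X)"
  \<comment> \<open>A divergent trace would have value 0, and \<open>1 / 0 = 0\<close> would
    contradict \<open>0 < \<gamma>\<close>. The step size condition thus forces the trace class
    case.\<close>
  have tr: "0 < ?tr"
    using \<gamma> \<tau> by (metis less_trans min_less_iff_conj zero_less_divide_1_iff zero_less_mult_pos)
  have sum_le: "(\<Sum>j<n. ?lam j) \<le> ?tr" for n
  proof (rule sum_le_operator_trace[OF tr])
    show "(\<Sum>j<n. ?lam j * (u \<bullet> e j)\<^sup>2) \<le> covariance P X u \<bullet> u" for u
      using sum_le_suminf[of "\<lambda>j. ?lam j * (u \<bullet> e j)\<^sup>2" "{..<n}"] sums[of u] by (auto simp: sums_iff)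
    show "norm (e i) = 1" for i using e[of i i] by (simp add: norm_eq_1)
  qed simp
  have summ: "summable ?lam"
    by (rule summableI_nonneg_bounded[OF _ sum_le]) simp
  have "suminf ?lam \<le> ?tr"
    by (rule suminf_le_const[OF summ sum_le])
  then have "\<gamma> * \<tau> * suminf ?lam \<le> \<gamma> * \<tau> * ?tr"
    using \<gamma> \<tau> by (intro mult_left_mono) auto
  also have "\<dots> \<le> 1"
    using \<gamma> \<tau> tr by (simp add: pos_less_divide_eq mult.assoc less_imp_le)
  finally have gt: "\<gamma> * \<tau> * suminf ?lam \<le> 1" .
  \<comment> \<open>This is the threshold \<open>3 * \<tau> * R\<^sup>2 / \<gamma>\<close> for
    \<open>T\<close>, turned into one for \<open>n\<close> by the quadratic bound of
    \<open>node_count_bounds\<close>.\<close>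
  have "\<forall>\<^sub>F n in sequentially. \<gamma> / R\<^sup>2 * (3 * \<tau> * R\<^sup>2 / \<gamma>)\<^sup>2 \<le> real n"
    using filterlim_real_sequentially by (simp add: filterlim_at_top)
  moreover have "\<forall>\<^sub>F n in sequentially. 0 < n" by (rule eventually_gt_at_top)
  ultimately show "\<forall>\<^sub>F n in sequentially. \<forall>Z. iid_split_sample P X Y (M n) n Z \<longrightarrow>
      (\<integral>\<^sup>+\<omega>. risk P X Y (distributed_sgd \<gamma> 0 (M n) n (\<lambda>m t. Z m t \<omega>)) \<partial>P)
        \<le> risk P X Y ws + ennreal ((2 + 18 * \<sigma>\<^sup>2) / \<gamma> * (\<gamma> / real (M n)) * (real (M n) / real n) powr (r / (1 + r)))"
    using M
  proof eventually_elim
    case (elim n)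
    define T where "T = n div M n"
    have n: "n = M n * T" using elim by (simp add: T_def)
    with elim have pos: "0 < M n" "0 < T" by (auto intro: Nat.gr0I)
    let ?B = "(2 + 18 * \<sigma>\<^sup>2) / \<gamma> * (\<gamma> / real (M n)) * (real (M n) / real n) powr (r / (1 + r))"
    show ?case
    proof (intro allI impI)
      fix Z assume Z: "iid_split_sample P X Y (M n) n Z"
      show "(\<integral>\<^sup>+\<omega>. risk P X Y (distributed_sgd \<gamma> 0 (M n) n (\<lambda>m t. Z m t \<omega>)) \<partial>P)
        \<le> risk P X Y ws + ennreal ?B"
      \<comment> \<open>For infinite minimal risk the right-hand side is infinite and the bound is
        trivial.\<close>
      proof (cases "risk P X Y ws = \<infinity>")
        case False
        have opt: "risk P X Y ws \<le> risk P X Y v" for v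
          using min by (simp add: min_norm_minimizer_def)
        note rm = risk_minimizer[OF X Y sq opt False]
        have model: "sgd_sample P X Y ws e ?lam \<tau> (\<sigma>\<^sup>2) \<gamma> (M n) T (\<lambda>(m, t). Z m t)"
        proof unfold_locales
          fix v and i j :: nat
          show "e i \<bullet> e j = (if i = j then 1 else 0)" by (rule e)
          show "(\<integral>\<omega>. (v \<bullet> X \<omega>) * (e j \<bullet> X \<omega>) \<partial>P) = ?lam j * (v \<bullet> e j)"
            using cov[of "e j" v] by (simp add: He inner_commute[of "e j"] mult.commute)
          show "(\<lambda>j. ?lam j * (v \<bullet> e j)\<^sup>2) sums (\<integral>\<omega>. (v \<bullet> X \<omega>)\<^sup>2 \<partial>P)"
            using sums[of v] unfolding cov_sq .
          show "integrable P (\<lambda>\<omega>. ((Y \<omega> - ws \<bullet> X \<omega>) * (e j \<bullet> X \<omega>))\<^sup>2)"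
              "(\<integral>\<omega>. ((Y \<omega> - ws \<bullet> X \<omega>) * (e j \<bullet> X \<omega>))\<^sup>2 \<partial>P) \<le> \<sigma>\<^sup>2 * ?lam j"
            using whitened_noise_bound[OF wn, of "e j"] lam_pos[of j] unfolding He_e by simp_all
          show "integrable P (\<lambda>\<omega>. ((v \<bullet> X \<omega>) * (e j \<bullet> X \<omega>))\<^sup>2)"
            by (rule rank_one_fourth_moment[OF ex fm])
          show "(\<integral>\<omega>. ((v \<bullet> X \<omega>) * (e j \<bullet> X \<omega>))\<^sup>2 \<partial>P) \<le> \<tau> * (\<integral>\<omega>. (v \<bullet> X \<omega>)\<^sup>2 \<partial>P) * ?lam j"
            using rank_one_fourth_moment(2)[OF ex fm, of v "e j"] unfolding He_e cov_sq[of v] .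
        next
          fix i assume "i \<in> {..<M n} \<times> {..<T}"
          then show "distr P borel (case i of (m, t) \<Rightarrow> Z m t) = distr P borel (\<lambda>\<omega>. (X \<omega>, Y \<omega>))"
            using Z unfolding iid_split_sample_def T_def by auto
        next
          show "indep_vars (\<lambda>_. borel) (\<lambda>(m, t). Z m t) ({..<M n} \<times> {..<T})"
            using Z unfolding iid_split_sample_def T_def by blast
        qed (rule X Y lam_nonneg lam_le summ sq rm(1) rm(2) zero_le_power2 less_imp_le[OF \<tau>] \<gamma>(1) \<gamma>1 gt)+
        have MT: "M n * T = n" using n by simp
        have risk: "risk P X Y (distributed_sgd \<gamma> 0 (M n) n (\<lambda>m t. Z m t \<omega>)) = risk P X Y ws
            + ennreal ((\<integral>\<omega>'. ((distributed_sgd \<gamma> 0 (M n) n (\<lambda>m t. Z m t \<omega>) - ws) \<bullet> X \<omega>')\<^sup>2 \<partial>P) / 2)" for \<omega>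
          by (rule rm(3))
        show ?thesis
          using sgd_sample.power_law_excess_bound[OF model r refl ws R _ pos refl, of "risk P X Y ws"] elim \<gamma>
          unfolding MT risk by simp
      qed simp
    qed
  qed
qed

end
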